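(* Let $n\ge4$. For any $c\in W_{D_n^{(1)}}^0=\mathcal C_{2n}^{s,p}$, we have $$L_{D_n^{(1)}}(c)=L_{D_{n+1}^{(2)}}(c)-a_0^{D_{n+1}^{(2)}}(c)-a_n^{D_{n+1}^{(2)}}(c)=\frac12\big(L(c)-a_0(c)-a_n(c)\big).$$
   Context: A $2n$-core is a partition having no hook length equal to $2n$; $\mathcal C_{2n}$ is the set of $2n$-cores, $\mathcal C_{2n}^s$ the subset of self-conjugate ones, and $\mathcal C_{2n}^{s,p}$ the subset of $\mathcal C_{2n}^s$ of cores with an even number of boxes on the main diagonal. The box in row $i$, column $j$ has residue $(j-i)\bmod 2n$; boxes of residue $i$ are $i$-nodes. The affine Weyl group $\widetilde{\mathfrak S}_{2n}$ of type $A_{2n-1}^{(1)}$, with simple reflections $s_0,\dots,s_{2n-1}$, acts on $\mathcal C_{2n}$: $s_i\cdot c$ is obtained by removing all removable $i$-nodes of $c$ if there are some, adding all addable $i$-nodes if there are some, and $s_i\cdot c=c$ otherwise. $L(c)$ is the number of boxes of $c$ and $a_i(c)$ the number of boxes of residue $i$. Let $\alpha_0,\dots,\alpha_{2n-1}$, $\Lambda_0,\dots,\Lambda_{2n-1}$ be the simple roots and fundamental weights of type $A_{2n-1}^{(1)}$, with $\widetilde{\mathfrak S}_{2n}$ acting by $s_i(x)=x-\langle x,\alpha_i^\vee\rangle\alpha_i$. Type $D_{n+1}^{(2)}$ is realized by $\alpha_0^{D_{n+1}^{(2)}}=\alpha_0$, $\alpha_i^{D_{n+1}^{(2)}}=\alpha_i+\alpha_{2n-i}$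 ($1\le i\le n-1$), $\alpha_n^{D_{n+1}^{(2)}}=\alpha_n$, $\Lambda_0^{D_{n+1}^{(2)}}=\Lambda_0$, with Weyl group generated by $s_0$, $s_is_{2n-i}$ ($1\le i\le n-1$), $s_n$. Type $D_n^{(1)}$ is realized by $\alpha_i^{D_n^{(1)}}=\alpha_i^{D_{n+1}^{(2)}}$ ($1\le i\le n-1$), $\alpha_0^{D_n^{(1)}}=2\alpha_0^{D_{n+1}^{(2)}}+\alpha_1^{D_{n+1}^{(2)}}$, $\alpha_n^{D_n^{(1)}}=2\alpha_n^{D_{n+1}^{(2)}}+\alpha_{n-1}^{D_{n+1}^{(2)}}$, $\Lambda_0^{D_n^{(1)}}=\Lambda_0^{D_{n+1}^{(2)}}$, with Weyl group $W_{D_n^{(1)}}$ generated by $s_0s_1s_{2n-1}s_0$ (index $0$), $s_is_{2n-i}$ (index $i$, $1\le i\le n-1$), $s_ns_{n-1}s_{n+1}s_n$ (index $n$). The affine Grassmannian (minimal length representatives of left cosets modulo the finite Weyl group generated by the generators of index $1,\dots,n$) of type $D_{n+1}^{(2)}$, resp. $D_n^{(1)}$, is identified with $\mathcal C_{2n}^s$, resp. $\mathcal C_{2n}^{s,p}$, via $w\mapsto w\cdot\varnothing$. For $X$ either of these two types and $w$ in its Weyl group with $c=w\cdot\varnothing$, write $\Lambda_0^X-w(\Lambda_0^X)=\sum_{i=0}^n a_i^X(c)\alpha_i^X$ (this depends only on $c$); the atomic length is $L_X(c)=\sum_{i=0}^n a_i^X(c)$. *)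

theory Defs
  imports Complex_Main "HOL-Library.Function_Algebras" "HOL-Library.Product_Plus"
begin

section \<open>Partitions and cores\<close>

text \<open>
  A partition is identified with its Young diagram, a finite set of boxes (row, column) closed
  towards the top left corner. Rows and columns are counted from 0; this affects neither
  the residues nor the main diagonal. The conjugate partition is the converse relation.
\<close>

type_synonym diagram = "(nat \<times> nat) set"

definition partition :: "diagram \<Rightarrow> bool" where
  "partition c \<longleftrightarrow> finite c \<and>
     (\<forall>i j i' j'. (i, j) \<in> c \<longrightarrow> i' \<le> i \<longrightarrow> j' \<le> j \<longrightarrow> (i', j') \<in> c)"

definition hook_length :: "diagram \<Rightarrow> nat \<Rightarrow> nat \<Rightarrow> nat" where
  "hook_length c i j =
     card {j'. j < j' \<and> (i, j') \<in> c} + card {i'. i < i' \<and> (i', j) \<in> c} + 1"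

definition cores :: "nat \<Rightarrow> diagram set" where
  "cores e = {c. partition c \<and> (\<forall>(i, j) \<in> c. hook_length c i j \<noteq> e)}"

definition sc_cores :: "nat \<Rightarrow> diagram set" where
  "sc_cores e = {c \<in> cores e. c\<inverse> = c}"

definition sc_even_cores :: "nat \<Rightarrow> diagram set" where
  "sc_even_cores e = {c \<in> sc_cores e. even (card {i. (i, i) \<in> c})}"

definition residue :: "nat \<Rightarrow> nat \<times> nat \<Rightarrow> nat" where
  "residue e b = nat ((int (snd b) - int (fst b)) mod int e)"

definition residue_count :: "nat \<Rightarrow> nat \<Rightarrow> diagram \<Rightarrow> nat" where
  "residue_count e i c = card {b \<in> c. residue e b = i}"

definition addable :: "nat \<Rightarrow> nat \<Rightarrow> diagram \<Rightarrow> diagram" where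
  "addable e i c = {b. b \<notin> c \<and> partition (insert b c) \<and> residue e b = i}"

definition removable :: "nat \<Rightarrow> nat \<Rightarrow> diagram \<Rightarrow> diagram" where
  "removable e i c = {b. b \<in> c \<and> partition (c - {b}) \<and> residue e b = i}"

definition core_reflection :: "nat \<Rightarrow> nat \<Rightarrow> diagram \<Rightarrow> diagram" where
  "core_reflection e i c =
     (if removable e i c \<noteq> {} then c - removable e i c
      else if addable e i c \<noteq> {} then c \<union> addable e i c
      else c)"

section \<open>Weights of type $A^{(1)}_{e-1}$\<close>

text \<open>
  We use the basis consisting of the fundamental weights and the null root \<open>\<delta>\<close>: the pair
  \<open>(x, d)\<close> stands for \<open>\<Sum>i<e. x i \<Lambda>\<^sub>i + d \<delta>\<close>, so that \<open>x i\<close> is its pairing with the simple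
  coroot of index \<open>i\<close>. The term \<open>\<delta>\<close> in \<open>\<alpha>\<^sub>0\<close> makes the simple roots linearly independent,
  with sum \<open>\<delta>\<close>. The Cartan matrix below is the correct one for \<open>e \<ge> 3\<close>.
\<close>

type_synonym weight = "(nat \<Rightarrow> real) \<times> real"

definition scale :: "real \<Rightarrow> weight \<Rightarrow> weight" where
  "scale r v = ((\<lambda>i. r * fst v i), r * snd v)"

definition cartan :: "nat \<Rightarrow> nat \<Rightarrow> nat \<Rightarrow> real" where
  "cartan e i j =
     (if i = j then 2 else if i = (j + 1) mod e \<or> j = (i + 1) mod e then -1 else 0)"

definition fundamental_weight :: "nat \<Rightarrow> weight" where
  "fundamental_weight j = ((\<lambda>i. if i = j then 1 else 0), 0)"

definition simple_root :: "nat \<Rightarrow> nat \<Rightarrow> weight" where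
  "simple_root e j = ((\<lambda>i. if i < e then cartan e i j else 0), if j = 0 then 1 else 0)"

definition coroot_pairing :: "weight \<Rightarrow> nat \<Rightarrow> real" where
  "coroot_pairing v i = fst v i"

definition weight_reflection :: "nat \<Rightarrow> nat \<Rightarrow> weight \<Rightarrow> weight" where
  "weight_reflection e i v = v - scale (coroot_pairing v i) (simple_root e i)"

section \<open>The types $D^{(2)}_{n+1}$ and $D^{(1)}_n$ inside $A^{(1)}_{2n-1}$\<close>

datatype dtype = D2 \<comment> \<open>$D^{(2)}_{n+1}$\<close> | D1 \<comment> \<open>$D^{(1)}_n$\<close>

definition root_D2 :: "nat \<Rightarrow> nat \<Rightarrow> weight" where
  "root_D2 n i =
     (if i = 0 then simple_root (2 * n) 0
      else if i = n then simple_root (2 * n) n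
      else simple_root (2 * n) i + simple_root (2 * n) (2 * n - i))"

definition root_D1 :: "nat \<Rightarrow> nat \<Rightarrow> weight" where
  "root_D1 n i =
     (if i = 0 then scale 2 (root_D2 n 0) + root_D2 n 1
      else if i = n then scale 2 (root_D2 n n) + root_D2 n (n - 1)
      else root_D2 n i)"

fun dtype_root :: "dtype \<Rightarrow> nat \<Rightarrow> nat \<Rightarrow> weight" where
  "dtype_root D2 n i = root_D2 n i"
| "dtype_root D1 n i = root_D1 n i"

text \<open>
  A word \<open>[i\<^sub>1, \<dots>, i\<^sub>k]\<close> stands for the product \<open>s\<^sub>i\<^sub>1 \<cdots> s\<^sub>i\<^sub>k\<close> of simple reflections of type
  $A^{(1)}_{2n-1}$; it acts on cores and on weights by composing the reflections, the rightmost
  factor first. Since the generators of both Weyl groups are involutions, every element is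
  a product of generators, i.e. is given by a word in \<open>weyl_words\<close>.
\<close>

fun generator :: "dtype \<Rightarrow> nat \<Rightarrow> nat \<Rightarrow> nat list" where
  "generator D2 n i =
     (if i = 0 then [0] else if i = n then [n] else [i, 2 * n - i])"
| "generator D1 n i =
     (if i = 0 then [0, 1, 2 * n - 1, 0]
      else if i = n then [n, n - 1, n + 1, n]
      else [i, 2 * n - i])"

definition weyl_words :: "dtype \<Rightarrow> nat \<Rightarrow> nat list set" where
  "weyl_words X n = {concat (map (generator X n) us) | us. set us \<subseteq> {0..n}}"

definition act_core :: "nat \<Rightarrow> nat list \<Rightarrow> diagram \<Rightarrow> diagram" where
  "act_core e w c = foldr (core_reflection e) w c"

definition act_weight :: "nat \<Rightarrow> nat list \<Rightarrow> weight \<Rightarrow> weight" where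
  "act_weight e w v = foldr (weight_reflection e) w v"

text \<open>
  The coefficients \<open>a\<^sub>i\<^sup>X(c)\<close>; they are set to 0 outside \<open>{0..n}\<close> to make the description definite.
  The weight \<open>\<Lambda>\<^sub>0\<close> of both types is the one of type $A^{(1)}_{2n-1}$.
\<close>

definition root_coeff :: "dtype \<Rightarrow> nat \<Rightarrow> diagram \<Rightarrow> nat \<Rightarrow> real" where
  "root_coeff X n c = (THE a. (\<forall>i>n. a i = 0) \<and>
     (\<exists>w \<in> weyl_words X n. act_core (2 * n) w {} = c \<and>
        fundamental_weight 0 - act_weight (2 * n) w (fundamental_weight 0)
          = (\<Sum>i = 0..n. scale (a i) (dtype_root X n i))))"

definition atomic_length :: "dtype \<Rightarrow> nat \<Rightarrow> diagram \<Rightarrow> real" where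
  "atomic_length X n c = (\<Sum>i = 0..n. root_coeff X n c i)"

end

theory Submission imports Defs begin

text \<open>
  The action of a word \<open>w\<close> on the weight \<open>\<Lambda>\<^sub>0\<close> mirrors its action on the empty core: if \<open>w\<close> leads to the
  core \<open>c\<close>, then \<open>\<Lambda>\<^sub>0 - w \<Lambda>\<^sub>0 = \<Sum>\<^sub>j a\<^sub>j(c) \<alpha>\<^sub>j\<close>, where \<open>a\<^sub>j(c)\<close> counts the boxes of residue \<open>j\<close>
  (\<open>act_weight_word\<close>, \<open>residue_count_diagram_of\<close>). For a self-conjugate core, \<open>a\<^sub>j = a\<^sub>2\<^sub>n\<^sub>-\<^sub>j\<close>, so this sum
  is \<open>a\<^sub>0 \<beta>\<^sub>0 + \<dots> + a\<^sub>n \<beta>\<^sub>n\<close> in the roots \<open>\<beta>\<^sub>i\<close> of type $D^{(2)}_{n+1}$. The roots of type $D^{(1)}_n$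
  are \<open>2 \<beta>\<^sub>0 + \<beta>\<^sub>1\<close>, \<open>\<beta>\<^sub>i\<close> for \<open>0 < i < n\<close>, and \<open>2 \<beta>\<^sub>n + \<beta>\<^sub>n\<^sub>-\<^sub>1\<close>; passing to them halves the
  coefficients at the two ends and subtracts these halves from the coefficients of index 1 and
  \<open>n - 1\<close>. The sum of all coefficients thereby becomes \<open>a\<^sub>1 + \<dots> + a\<^sub>n\<^sub>-\<^sub>1\<close>, and by symmetry this is half
  of the number of boxes whose residue is neither 0 nor \<open>n\<close>.

  The coefficients are described by a definite description over words, so it remains to see that
  it has exactly one solution. Uniqueness is the linear independence of the roots
  (\<open>dtype_roots_independent\<close>). Existence means that every core in question is reached by a word of the
  right type. For $D^{(2)}_{n+1}$, a self-conjugate core is dismantled symmetrically, residue by residue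
  (\<open>core_in_orbit_D2\<close>). For $D^{(1)}_n$, conjugation by \<open>s\<^sub>0\<close> and by \<open>s\<^sub>n\<close> permutes the generators, and
  \<open>s\<^sub>n\<close> fixes the empty core, so the self-conjugate cores are covered by the $D^{(1)}_n$ orbit of the empty
  core and the image of this orbit under \<open>s\<^sub>0\<close> (\<open>orbit_D2_cosets\<close>). The parity of the main diagonal
  separates the two: \<open>s\<^sub>0\<close> always changes it, and the $D^{(1)}_n$ generators preserve it.

  Cores are handled through an integer function that records the lengths of their diagonals, up to a
  shift that depends only on the content. The simple reflections then become linear maps, and the
  relations between them become identities that hold for all functions.
\<close>

section \<open>Partitions and their profiles\<close>

text \<open>
  A partition is encoded by its profile: \<open>t k\<close> is the row of the first box of content \<open>k\<close>
  (column minus row) that is not in the diagram. Along the boundary, \<open>t k - t (k + 1)\<close> is 1 or 0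
  according as the step from content \<open>k\<close> to \<open>k + 1\<close> is vertical or horizontal, so profiles are
  the sums of the usual 0/1 boundary sequences (Maya diagrams). The values are integers, although
  never negative, in order that the reflections below are linear.
\<close>
type_synonym profile = "int \<Rightarrow> int"

definition ground :: profile where
  "ground k = max 0 (- k)"

definition is_profile :: "profile \<Rightarrow> bool" where
  "is_profile t \<longleftrightarrow> (\<forall>k. t (k + 1) \<le> t k \<and> t k \<le> t (k + 1) + 1) \<and>
     (\<exists>N. \<forall>k. N \<le> \<bar>k\<bar> \<longrightarrow> t k = ground k)"

definition diagram_of :: "profile \<Rightarrow> diagram" where
  "diagram_of t = {(i, j). int i < t (int j - int i)}"

text \<open>
  In terms of boundary steps: a horizontal step at \<open>k - e\<close> forces a horizontal step at \<open>k\<close>.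
  A violation of this is exactly a hook of length \<open>e\<close>.
\<close>
definition core_profile :: "nat \<Rightarrow> profile \<Rightarrow> bool" where
  "core_profile e t \<longleftrightarrow> is_profile t \<and>
     (\<forall>k. t (k - int e) = t (k - int e + 1) \<longrightarrow> t k = t (k + 1))"

text \<open>
  Transposing a diagram turns the profile \<open>t\<close> into \<open>\<lambda>k. t (- k) - k\<close>.
\<close>
definition self_conjugate :: "profile \<Rightarrow> bool" where
  "self_conjugate t \<longleftrightarrow> (\<forall>k. t k = t (- k) - k)"

text \<open>
  Replacing \<open>t k\<close> by \<open>t (k - 1) + t (k + 1) - t k\<close> exchanges the boundary steps on the two sides
  of content \<open>k\<close>: it adds an addable box, removes a removable one, and does nothing if there is
  neither. The formula makes involutivity and commutation statements about arbitrary functions.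
\<close>
definition reflect :: "nat \<Rightarrow> nat \<Rightarrow> profile \<Rightarrow> profile" where
  "reflect e i t = (\<lambda>k. if int e dvd k - int i then t (k - 1) + t (k + 1) - t k else t k)"

lemma core_profile_imp_profile: "core_profile e t \<Longrightarrow> is_profile t"
  unfolding core_profile_def by blast

lemma profile_step:
  assumes "is_profile t"
  shows "t (k + 1) \<le> t k" "t k \<le> t (k + 1) + 1" "t k \<le> t (k - 1)" "t (k - 1) \<le> t k + 1"
proof -
  have *: "\<And>k. t (k + 1) \<le> t k \<and> t k \<le> t (k + 1) + 1"
    using assms by (auto simp: is_profile_def)
  show "t (k + 1) \<le> t k" "t k \<le> t (k + 1) + 1" using * by auto
  show "t k \<le> t (k - 1)" "t (k - 1) \<le> t k + 1" using *[of "k - 1"] by auto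
qed

lemma profile_mono:
  assumes "is_profile t" "a \<le> b"
  shows "t b \<le> t a" "t a \<le> t b + (b - a)"
proof -
  have "t b \<le> t a \<and> t a \<le> t b + (b - a)"
    using assms(2)
  proof (induction b rule: int_ge_induct)
    case (step b)
    then show ?case using profile_step(1,2)[OF assms(1), of b] by linarith
  qed simp
  then show "t b \<le> t a" "t a \<le> t b + (b - a)" by auto
qed

lemma profile_eventually_ground:
  assumes "is_profile t"
  obtains N where "N > 0" "\<And>k. N \<le> \<bar>k\<bar> \<Longrightarrow> t k = ground k"
proof -
  obtain N where N: "\<forall>k. N \<le> \<bar>k\<bar> \<longrightarrow> t k = ground k"
    using assms by (auto simp: is_profile_def)
  show thesis by (rule that[of "max N 1"]) (use N in auto)
qed

lemma ground_le_profile: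
  assumes "is_profile t"
  shows "ground k \<le> t k"
proof -
  obtain N where N: "N > 0" "\<And>k. N \<le> \<bar>k\<bar> \<Longrightarrow> t k = ground k"
    using profile_eventually_ground[OF assms] by blast
  define M where "M = max N \<bar>k\<bar>"
  have "t M = 0" "t (- M) = M" using N by (auto simp: M_def ground_def)
  moreover have "k \<le> M" "- M \<le> k" by (auto simp: M_def)
  ultimately show ?thesis
    using profile_mono(1)[OF assms, of k M] profile_mono(2)[OF assms, of "- M" k]
    by (auto simp: ground_def)
qed

lemma is_profile_ground: "is_profile ground"
  unfolding is_profile_def ground_def by auto

lemma core_profile_ground: "core_profile e ground"
  using is_profile_ground unfolding core_profile_def ground_def by auto

lemma self_conjugate_ground: "self_conjugate ground"
  unfolding self_conjugate_def ground_def by auto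

lemma diagram_of_ground: "diagram_of ground = {}"
  unfolding diagram_of_def ground_def by auto

lemma mem_diagram_of: "(i, j) \<in> diagram_of t \<longleftrightarrow> int i < t (int j - int i)"
  by (simp add: diagram_of_def)

lemma finite_diagram_of:
  assumes "is_profile t"
  shows "finite (diagram_of t)"
proof -
  obtain N where N: "N > 0" "\<And>k. N \<le> \<bar>k\<bar> \<Longrightarrow> t k = ground k"
    using profile_eventually_ground[OF assms] by blast
  have "diagram_of t \<subseteq> {..<nat N} \<times> {..<nat (2 * N)}"
  proof (clarsimp simp: diagram_of_def)
    fix i j :: nat
    let ?k = "int j - int i"
    assume *: "int i < t ?k"
    have "- N < ?k"
      using N(2)[of ?k] * by (cases "- N < ?k") (auto simp: ground_def)
    moreover have "?k < N"
      using N(2)[of ?k] * \<open>N > 0\<close> by (cases "?k < N") (auto simp: ground_def)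
    moreover have "t (- N) = N" using N by (auto simp: ground_def)
    ultimately show "i < nat N \<and> j < nat (2 * N)"
      using profile_mono(1)[OF assms, of "- N" ?k] * by auto
  qed
  then show ?thesis by (rule finite_subset) auto
qed

lemma partition_diagram_of:
  assumes "is_profile t"
  shows "partition (diagram_of t)"
  unfolding partition_def
proof (intro conjI allI impI)
  fix i j i' j'
  assume *: "(i, j) \<in> diagram_of t" "i' \<le> i" "j' \<le> j"
  let ?k = "int j - int i" and ?k' = "int j' - int i'" and ?m = "int j - int i'"
  have "t ?k \<le> t ?m + (int i - int i')"
    using profile_mono(2)[OF assms, of ?k ?m] * by simp
  moreover have "t ?m \<le> t ?k'" using profile_mono(1)[OF assms, of ?k' ?m] * by simp
  ultimately show "(i', j') \<in> diagram_of t"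
    using * by (simp add: mem_diagram_of)
qed (rule finite_diagram_of[OF assms])

text \<open>
  Closure under moving up and to the left makes the boxes of each fixed content an initial
  segment of their diagonal, so the first missing one determines the diagonal.
\<close>
lemma partition_has_profile:
  assumes "partition c"
  obtains t where "is_profile t" "c = diagram_of t"
proof -
  have fin: "finite c" and
    closed: "\<And>i j i' j'. (i, j) \<in> c \<Longrightarrow> i' \<le> i \<Longrightarrow> j' \<le> j \<Longrightarrow> (i', j') \<in> c"
    using assms unfolding partition_def by blast+
  obtain N where N: "\<And>i j. (i, j) \<in> c \<Longrightarrow> i < N \<and> j < N"
  proof -
    have "finite (fst ` c \<union> snd ` c)" using fin by simp
    then obtain N where "\<forall>x \<in> fst ` c \<union> snd ` c. x < N"
      using finite_nat_set_iff_bounded by blast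
    then have "i < N \<and> j < N" if "(i, j) \<in> c" for i j
      using that by (metis UnI1 UnI2 fst_conv imageI snd_conv)
    then show thesis using that by blast
  qed
  define out where "out = (\<lambda>k i. 0 \<le> int i + k \<and> (i, nat (int i + k)) \<notin> c)"
  define t where "t = (\<lambda>k. int (LEAST i. out k i))"
  have ex: "\<exists>i. out k i" for k
    by (rule exI[of _ "N + nat (- k)"]) (auto simp: out_def dest: N)
  have t_out: "out k (nat (t k))" and t0: "t k \<ge> 0" for k
    unfolding t_def using LeastI_ex[OF ex] by auto
  have t_le: "t k \<le> int i" if "out k i" for k i
    unfolding t_def using Least_le[of "out k", OF that] by simp
  have mem: "(i, j) \<in> c \<longleftrightarrow> int i < t (int j - int i)" for i j
  proof
    assume ij: "(i, j) \<in> c"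
    show "int i < t (int j - int i)"
    proof (rule ccontr)
      assume "\<not> int i < t (int j - int i)"
      then have "nat (t (int j - int i)) \<le> i"
        and "nat (int (nat (t (int j - int i))) + (int j - int i)) \<le> j" by linarith+
      then show False
        using t_out[of "int j - int i"] closed[OF ij] unfolding out_def by blast
    qed
  next
    assume "int i < t (int j - int i)"
    then show "(i, j) \<in> c" using t_le[of "int j - int i" i] by (auto simp: out_def)
  qed
  have "t (k + 1) \<le> t k \<and> t k \<le> t (k + 1) + 1" for k
  proof
    have "out (k + 1) (nat (t k))"
      using t_out[of k] closed[of "nat (t k)" "nat (int (nat (t k)) + (k + 1))" "nat (t k)" "nat (int (nat (t k)) + k)"]
      by (auto simp: out_def nat_le_eq_zle)
    then show "t (k + 1) \<le> t k" using t_le t0[of k] by fastforce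
    let ?T = "nat (t (k + 1))"
    have "out k (?T + 1)"
      using t_out[of "k + 1"] closed[of "?T + 1" "nat (int (?T + 1) + k)" ?T "nat (int ?T + (k + 1))"]
      by (auto simp: out_def algebra_simps)
    then show "t k \<le> t (k + 1) + 1" using t_le[of k "?T + 1"] t0[of "k + 1"] by simp
  qed
  moreover have "t k = ground k" if "int N \<le> \<bar>k\<bar>" for k
  proof -
    have "out k (nat (- k))"
      using that N by (fastforce simp: out_def)
    then have "t k \<le> ground k" using t_le[of k "nat (- k)"] by (auto simp: ground_def max_def split: if_splits)
    moreover have "ground k \<le> t k" using t_out[of k] t0[of k] by (auto simp: ground_def out_def)
    ultimately show ?thesis by simp
  qed
  ultimately have "is_profile t" unfolding is_profile_def by blast
  moreover have "c = diagram_of t" by (auto simp: diagram_of_def mem)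
  ultimately show thesis by (rule that)
qed

text \<open>
  A horizontal step at \<open>k - e\<close> is the bottom end of a column and a vertical step at \<open>k\<close> is the right
  end of a row; if both occur, the box where this row and this column meet has hook length \<open>e\<close>.
\<close>
lemma core_has_core_profile:
  assumes "c \<in> cores e" "e > 0"
  obtains t where "core_profile e t" "c = diagram_of t"
proof -
  have part: "partition c" and
    hook: "\<And>i j. (i, j) \<in> c \<Longrightarrow> hook_length c i j \<noteq> e"
    using assms(1) by (auto simp: cores_def)
  obtain t where t: "is_profile t" and c: "c = diagram_of t"
    using partition_has_profile[OF part] .
  have "t k = t (k + 1)" if m: "t (k - int e) = t (k - int e + 1)" for k
  proof (rule ccontr)
    assume "t k \<noteq> t (k + 1)"
    then have k: "t k = t (k + 1) + 1" using profile_step(1,2)[OF t, of k] by auto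
    \<comment> \<open>\<open>i\<close> is the row that ends at content \<open>k\<close>, and \<open>j\<close> the column of height \<open>T\<close> that ends at \<open>k - e\<close>.\<close>
    define i where "i = nat (t (k + 1))"
    define T where "T = nat (t (k - int e))"
    define j where "j = nat (int T + (k - int e))"
    have i: "int i = t (k + 1)"
      using ground_le_profile[OF t, of "k + 1"] by (simp add: i_def ground_def)
    have T: "int T = t (k - int e)"
      using ground_le_profile[OF t, of "k - int e"] by (simp add: T_def ground_def)
    have j: "int j = int T + (k - int e)"
      using ground_le_profile[OF t, of "k - int e"] T by (simp add: j_def ground_def)
    have row: "(i, j') \<in> c \<longleftrightarrow> int j' \<le> int i + k" for j'
      using profile_mono(1)[OF t, of "int j' - int i" k]
        profile_mono(1)[OF t, of "k + 1" "int j' - int i"] i k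
      unfolding c mem_diagram_of by linarith
    have column: "(i', j) \<in> c \<longleftrightarrow> i' < T" for i'
      using profile_mono(2)[OF t, of "k - int e + 1" "int j - int i'"]
        profile_mono(2)[OF t, of "int j - int i'" "k - int e"] T j m
      unfolding c mem_diagram_of by linarith
    have "t (k - int e + 1) \<le> t k + (int e - 1)"
      using profile_mono(2)[OF t, of "k - int e + 1" k] assms(2) by simp
    then have box: "int j \<le> int i + k" and iT: "i < T"
      using i k T j m assms(2) profile_mono(1)[OF t, of "k - int e + 1" k] by linarith+
    have "{j'. j < j' \<and> (i, j') \<in> c} = {j<..nat (int i + k)}"
      using box by (auto simp: row)
    moreover have "{i'. i < i' \<and> (i', j) \<in> c} = {i<..<T}" by (auto simp: column)
    ultimately have "hook_length c i j = e"
      using box iT i k T j by (simp add: hook_length_def)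
    then show False using hook[of i j] box by (simp add: row)
  qed
  then show thesis using that[of t] t c unfolding core_profile_def by blast
qed

lemma diagram_of_inject:
  assumes "is_profile t" "is_profile t'" "diagram_of t = diagram_of t'"
  shows "t = t'"
proof
  fix k
  have *: "t k \<le> t' k" if "is_profile t" "is_profile t'" "diagram_of t \<subseteq> diagram_of t'" for t t'
  proof (rule ccontr)
    assume l: "\<not> t k \<le> t' k"
    have g: "ground k \<le> t' k" using ground_le_profile that by blast
    define i where "i = nat (t' k)"
    define j where "j = nat (t' k + k)"
    have "int i = t' k" "int j - int i = k" using g by (auto simp: i_def j_def ground_def)
    then have "(i, j) \<in> diagram_of t" "(i, j) \<notin> diagram_of t'"
      using l by (auto simp: mem_diagram_of)
    then show False using that by auto
  qed
  show "t k = t' k" using *[of t t'] *[of t' t] assms by auto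
qed

text \<open>
  The transposed diagram has a profile of its own, and profiles are determined by diagrams.
\<close>
lemma self_conjugate_diagram:
  assumes "is_profile t" "(diagram_of t)\<inverse> = diagram_of t"
  shows "self_conjugate t"
proof -
  define u where "u = (\<lambda>k. t (- k) - k)"
  have "(diagram_of t)\<inverse> = diagram_of u"
    by (auto simp: diagram_of_def u_def)
  moreover have "is_profile u"
  proof -
    obtain N where N: "N > 0" "\<And>k. N \<le> \<bar>k\<bar> \<Longrightarrow> t k = ground k"
      using profile_eventually_ground[OF assms(1)] by blast
    have "u k = ground k" if "N \<le> \<bar>k\<bar>" for k
      using N(2)[of "- k"] that by (auto simp: u_def ground_def)
    moreover have "u (k + 1) \<le> u k \<and> u k \<le> u (k + 1) + 1" for k
      using profile_step(3,4)[OF assms(1), of "- k"] by (simp add: u_def)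
    ultimately show ?thesis unfolding is_profile_def by blast
  qed
  ultimately have "t = u" using diagram_of_inject assms by metis
  then show ?thesis unfolding self_conjugate_def u_def by metis
qed

lemma diagonal_length:
  assumes "is_profile t"
  shows "int (card {i. (i, i) \<in> diagram_of t}) = t 0"
proof -
  have "{i. (i, i) \<in> diagram_of t} = {..<nat (t 0)}" by (auto simp: mem_diagram_of)
  then show ?thesis using ground_le_profile[OF assms, of 0] by (simp add: ground_def)
qed

section \<open>Simple reflections on cores and on profiles\<close>

lemma not_both_dvd: "\<not> d dvd a - b \<Longrightarrow> \<not> (d dvd a \<and> d dvd b)" for a b d :: int
  by (blast intro: dvd_diff)

lemma not_dvd_neighbours:
  assumes "e \<ge> 2" "int e dvd k - int i"
  shows "\<not> int e dvd k + 1 - int i" "\<not> int e dvd k - 1 - int i"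
proof -
  have *: "\<not> int e dvd 1" using assms zdvd_not_zless[of 1 "int e"] by simp
  show "\<not> int e dvd k + 1 - int i"
    using assms(2) * not_both_dvd[of "int e" "k + 1 - int i" "k - int i"] by (simp add: algebra_simps)
  show "\<not> int e dvd k - 1 - int i"
    using assms(2) * not_both_dvd[of "int e" "k - int i" "k - 1 - int i"] by (simp add: algebra_simps)
qed

text \<open>
  The box of content \<open>k\<close> just outside the diagram is addable iff the boundary step before it is
  vertical and the step after it is horizontal. Whether the boxes above and to the left are
  present is decided by the profile at \<open>k + 1\<close> and \<open>k - 1\<close>.
\<close>
lemma addable_corner_iff:
  assumes t: "is_profile t"
  shows "(p, q) \<notin> diagram_of t \<and> partition (insert (p, q) (diagram_of t)) \<longleftrightarrow>
    (let k = int q - int p in int p = t k \<and> t (k - 1) = t k + 1 \<and> t (k + 1) = t k)"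
    (is "?L \<longleftrightarrow> ?R")
proof -
  define k where "k = int q - int p"
  define c where "c = diagram_of t"
  have nonneg: "t l \<ge> 0" "t l \<ge> - l" for l
    using ground_le_profile[OF t, of l] by (auto simp: ground_def)
  have "int p = t k \<and> t (k - 1) = t k + 1 \<and> t (k + 1) = t k" if L: ?L
  proof -
    have closed: "(i', j') \<in> c" if "i' \<le> p" "j' \<le> q" "(i', j') \<noteq> (p, q)" for i' j'
      using L that unfolding partition_def c_def by blast
    \<comment> \<open>in the first row or column the missing neighbour is replaced by the bound \<open>ground \<le> t\<close>\<close>
    have up: "t (k + 1) \<ge> int p"
    proof (cases p)
      case (Suc p')
      then have "(p', q) \<in> c" by (intro closed) auto
      then show ?thesis using Suc by (simp add: c_def mem_diagram_of k_def)
    qed (simp add: nonneg)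
    have left: "t (k - 1) \<ge> int p + 1"
    proof (cases q)
      case 0
      then show ?thesis using nonneg(2)[of "k - 1"] by (simp add: k_def)
    next
      case (Suc q')
      then have "(p, q') \<in> c" by (intro closed) auto
      then show ?thesis using Suc by (simp add: c_def mem_diagram_of k_def)
    qed
    have "t k \<le> int p" using L by (simp add: mem_diagram_of k_def)
    then show ?thesis using up left profile_step[OF t, of k] by linarith
  qed
  moreover have ?L if R: "int p = t k \<and> t (k - 1) = t k + 1 \<and> t (k + 1) = t k"
  proof
    show "(p, q) \<notin> diagram_of t" using R by (simp add: mem_diagram_of k_def)
    have part: "finite c" "\<And>i j i' j'. (i, j) \<in> c \<Longrightarrow> i' \<le> i \<Longrightarrow> j' \<le> j \<Longrightarrow> (i', j') \<in> c"
      using partition_diagram_of[OF t] unfolding partition_def c_def by blast+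
    have "(i', j') \<in> insert (p, q) c" if "i' \<le> p" "j' \<le> q" for i' j'
    proof (cases "i' < p")
      case True
      then have "(p - 1, q) \<in> c"
        using R by (auto simp: c_def mem_diagram_of k_def of_nat_diff algebra_simps)
      then show ?thesis using part(2)[of "p - 1" q i' j'] that True by auto
    next
      case False
      show ?thesis
      proof (cases "j' < q")
        case True
        then have "(p, q - 1) \<in> c"
          using R by (auto simp: c_def mem_diagram_of k_def of_nat_diff algebra_simps)
        then show ?thesis using part(2)[of p "q - 1" i' j'] that True by auto
      qed (use False that in auto)
    qed
    moreover have "finite (insert (p, q) c)" using part(1) by simp
    ultimately show "partition (insert (p, q) (diagram_of t))"
      using part(2) unfolding partition_def c_def[symmetric] by blast
  qed
  ultimately show ?thesis unfolding Let_def k_def by blast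
qed

lemma removable_corner_iff:
  assumes t: "is_profile t"
  shows "(p, q) \<in> diagram_of t \<and> partition (diagram_of t - {(p, q)}) \<longleftrightarrow>
    (let k = int q - int p in int p + 1 = t k \<and> t (k - 1) = t k \<and> t (k + 1) = t k - 1)"
    (is "?L \<longleftrightarrow> ?R")
proof -
  define k where "k = int q - int p"
  define c where "c = diagram_of t"
  have down: "(p + 1, q) \<in> c \<longleftrightarrow> int p + 1 < t (k - 1)"
    by (simp add: c_def mem_diagram_of k_def algebra_simps)
  have right: "(p, q + 1) \<in> c \<longleftrightarrow> int p < t (k + 1)"
    by (simp add: c_def mem_diagram_of k_def algebra_simps)
  have box: "(p, q) \<in> c \<longleftrightarrow> int p < t k"
    by (simp add: c_def mem_diagram_of k_def)
  have "int p + 1 = t k \<and> t (k - 1) = t k \<and> t (k + 1) = t k - 1" if L: ?L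
  proof -
    have closed: "(p, q) \<in> c - {(p, q)}" if "(i, j) \<in> c - {(p, q)}" "p \<le> i" "q \<le> j" for i j
      using L that unfolding partition_def c_def by blast
    have "(p + 1, q) \<notin> c" "(p, q + 1) \<notin> c"
      using closed[of "p + 1" q] closed[of p "q + 1"] by auto
    then show ?thesis using L down right box profile_step[OF t, of k] by (auto simp: c_def)
  qed
  moreover have ?L if R: "int p + 1 = t k \<and> t (k - 1) = t k \<and> t (k + 1) = t k - 1"
  proof
    show "(p, q) \<in> diagram_of t" using R box by (simp add: c_def)
    have part: "finite c" "\<And>i j i' j'. (i, j) \<in> c \<Longrightarrow> i' \<le> i \<Longrightarrow> j' \<le> j \<Longrightarrow> (i', j') \<in> c"
      using partition_diagram_of[OF t] unfolding partition_def c_def by blast+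
    have out: "(p + 1, q) \<notin> c" "(p, q + 1) \<notin> c" using R down right by auto
    have "(i, j) = (p, q)" if ij: "(i, j) \<in> c" "p \<le> i" "q \<le> j" for i j
    proof -
      have "\<not> p + 1 \<le> i" using part(2)[OF ij(1), of "p + 1" q] out ij by blast
      moreover have "\<not> q + 1 \<le> j" using part(2)[OF ij(1), of p "q + 1"] out ij by blast
      ultimately show ?thesis using ij by simp
    qed
    moreover have "finite (c - {(p, q)})" using part(1) by simp
    ultimately show "partition (diagram_of t - {(p, q)})"
      using part(2) unfolding partition_def c_def[symmetric] by blast
  qed
  ultimately show ?thesis unfolding Let_def k_def by blast
qed

lemma residue_eq_iff:
  assumes "i < e"
  shows "residue e (p, q) = i \<longleftrightarrow> int e dvd (int q - int p) - int i"
proof -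
  have "residue e (p, q) = i \<longleftrightarrow> (int q - int p) mod int e = int i mod int e"
    using assms pos_mod_bound[of "int e" "int q - int p"] pos_mod_sign[of "int e" "int q - int p"]
    by (auto simp: residue_def)
  then show ?thesis by (simp add: mod_eq_dvd_iff)
qed

text \<open>
  Iterating the core condition: within a class of contents modulo \<open>e\<close>, once a boundary step is
  horizontal, all later ones are.
\<close>
lemma core_profile_descent:
  assumes t: "core_profile e t" and "int e dvd k - m" "m \<le> k" "t m = t (m + 1)"
  shows "t k = t (k + 1)"
proof (cases "e = 0")
  case False
  obtain r where r: "k = m + int e * r" using assms(2) by (metis dvdE diff_add_cancel add.commute)
  then have "int e * r \<ge> 0" using assms(3) by simp
  then have "r \<ge> 0" using False by (simp add: zero_le_mult_iff)
  then obtain s where s: "r = int s" using nonneg_int_cases by blast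
  have "t (m + int e * int s) = t (m + int e * int s + 1)" for s
  proof (induction s)
    case (Suc s)
    have "m + int e * int (Suc s) - int e = m + int e * int s" by (simp add: algebra_simps)
    then show ?case using t Suc unfolding core_profile_def by metis
  qed (use assms(4) in simp)
  then show ?thesis using r s by simp
qed (use assms in simp)

text \<open>
  If a box of content \<open>k\<close> is removable and one of content \<open>m\<close> is addable, then a horizontal step
  precedes a vertical one in the class of \<open>k\<close> or in the class of \<open>k - 1\<close>, depending on the order
  of \<open>k\<close> and \<open>m\<close>. Both are excluded by the previous lemma.
\<close>
lemma core_not_addable_and_removable:
  assumes t: "core_profile e t" and "int e dvd k - m"
    and rem: "t (k - 1) = t k" "t (k + 1) = t k - 1"
  shows "\<not> (t (m - 1) = t m + 1 \<and> t (m + 1) = t m)"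
proof
  assume add: "t (m - 1) = t m + 1 \<and> t (m + 1) = t m"
  show False
  proof (cases "m \<le> k")
    case True
    then show False using core_profile_descent[OF t assms(2)] add rem by simp
  next
    case False
    have "int e dvd (m - 1) - (k - 1)" using assms(2) dvd_minus_iff[of "int e" "k - m"] by simp
    then show False using core_profile_descent[OF t, of "m - 1" "k - 1"] False add rem by simp
  qed
qed

text \<open>
  The boundary steps of the reflected profile are a rearrangement of the old ones, because
  neighbouring contents are never both congruent to \<open>i\<close> when \<open>e \<ge> 2\<close>.
\<close>
lemma is_profile_reflect:
  assumes t: "is_profile t" and e: "e \<ge> 2"
  shows "is_profile (reflect e i t)"
proof -
  obtain N where N: "N > 0" "\<And>k. N \<le> \<bar>k\<bar> \<Longrightarrow> t k = ground k"
    using profile_eventually_ground[OF t] by blast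
  have "reflect e i t k = ground k" if k: "N + 1 \<le> \<bar>k\<bar>" for k
  proof -
    have "t k = ground k" "t (k - 1) = ground (k - 1)" "t (k + 1) = ground (k + 1)"
      using k by (intro N(2); linarith)+
    then show ?thesis using k N(1) by (auto simp: reflect_def ground_def)
  qed
  moreover have "reflect e i t (k + 1) \<le> reflect e i t k \<and> reflect e i t k \<le> reflect e i t (k + 1) + 1" for k
  proof -
    have "\<not> int e dvd k + 1 - int i" if "int e dvd k - int i"
      using not_dvd_neighbours(1)[OF e that] .
    then show ?thesis
      using profile_step[OF t, of k] profile_step[OF t, of "k + 1"]
      by (auto simp: reflect_def algebra_simps)
  qed
  ultimately show ?thesis unfolding is_profile_def by blast
qed

text \<open>
  Reflecting commutes with shifting the argument by \<open>e\<close>, so the core condition, which compares \<open>t\<close>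
  with its shift \<open>u\<close> step by step, is carried along by the exchange of steps.
\<close>
lemma core_profile_reflect:
  assumes t: "core_profile e t" and e: "e \<ge> 2"
  shows "core_profile e (reflect e i t)"
proof -
  have prof: "is_profile t" and core: "\<And>k. t (k - int e) = t (k - int e + 1) \<Longrightarrow> t k = t (k + 1)"
    using t unfolding core_profile_def by blast+
  define u where "u = (\<lambda>k. t (k - int e))"
  have u: "t k = t (k + 1)" if "u k = u (k + 1)" for k
    using core[of k] that by (simp add: u_def algebra_simps)
  have shift: "reflect e i t (m - int e) = reflect e i u m" for m
  proof -
    have eq: "(m - int e) - int i = (m - int i) - int e" by simp
    have "int e dvd (m - int e) - int i \<longleftrightarrow> int e dvd m - int i"
      unfolding eq dvd_eq_mod_eq_0 by simp
    then show ?thesis by (simp add: reflect_def u_def algebra_simps)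
  qed
  have "reflect e i t k = reflect e i t (k + 1)"
    if "reflect e i t (k - int e) = reflect e i t (k - int e + 1)" for k
  proof -
    have *: "reflect e i u k = reflect e i u (k + 1)"
      using that shift[of k] shift[of "k + 1"] by (simp add: algebra_simps)
    consider "int e dvd k - int i" "\<not> int e dvd k + 1 - int i"
      | "\<not> int e dvd k - int i" "int e dvd k + 1 - int i"
      | "\<not> int e dvd k - int i" "\<not> int e dvd k + 1 - int i"
      using not_dvd_neighbours[OF e] by blast
    then show ?thesis
    proof cases
      case 1
      then show ?thesis using * u[of "k - 1"] by (simp add: reflect_def)
    next
      case 2
      then show ?thesis using * u[of "k + 1"] by (simp add: reflect_def)
    next
      case 3
      then show ?thesis using * u[of k] by (simp add: reflect_def)
    qed
  qed
  then show ?thesis using is_profile_reflect[OF prof e] unfolding core_profile_def by blast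
qed

text \<open>
  On a core all changes of residue \<open>i\<close> go in the same direction, so the case distinction in the
  action on diagrams agrees with the uniform formula on profiles.
\<close>
lemma core_reflection_diagram_of:
  assumes t: "core_profile e t" and "i < e"
  shows "core_reflection e i (diagram_of t) = diagram_of (reflect e i t)"
proof -
  have prof: "is_profile t" using core_profile_imp_profile[OF t] .
  define add where "add = (\<lambda>k. t (k - 1) = t k + 1 \<and> t (k + 1) = t k)"
  define rem where "rem = (\<lambda>k. t (k - 1) = t k \<and> t (k + 1) = t k - 1)"
  have addable: "(p, q) \<in> addable e i (diagram_of t) \<longleftrightarrow>
      int e dvd (int q - int p) - int i \<and> int p = t (int q - int p) \<and> add (int q - int p)" for p q
    using addable_corner_iff[OF prof, of p q] residue_eq_iff[OF assms(2), of p q]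
    unfolding addable_def add_def Let_def by blast
  have removable: "(p, q) \<in> removable e i (diagram_of t) \<longleftrightarrow>
      int e dvd (int q - int p) - int i \<and> int p + 1 = t (int q - int p) \<and> rem (int q - int p)" for p q
    using removable_corner_iff[OF prof, of p q] residue_eq_iff[OF assms(2), of p q]
    unfolding removable_def rem_def Let_def by blast
  have reflected: "reflect e i t k = (if int e dvd k - int i then
      (if add k then t k + 1 else if rem k then t k - 1 else t k) else t k)" for k
    using profile_step[OF prof, of k] by (auto simp: reflect_def add_def rem_def)
  show ?thesis
  proof (cases "removable e i (diagram_of t) = {}")
    case False
    then obtain p q where pq: "(p, q) \<in> removable e i (diagram_of t)" by auto
    have "\<not> add k" if "int e dvd k - int i" for k
    proof -
      have eq: "int q - int p - k = (int q - int p - int i) - (k - int i)" by simp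
      have "int e dvd int q - int p - k"
        unfolding eq using pq that unfolding removable by (blast intro: dvd_diff)
      then show ?thesis
        using core_not_addable_and_removable[OF t, of "int q - int p" k] pq
        unfolding removable add_def rem_def by blast
    qed
    then have "(i', j') \<in> diagram_of t - removable e i (diagram_of t) \<longleftrightarrow>
        (i', j') \<in> diagram_of (reflect e i t)" for i' j'
      unfolding Diff_iff removable mem_diagram_of reflected by auto
    then have "diagram_of t - removable e i (diagram_of t) = diagram_of (reflect e i t)" by auto
    then show ?thesis using False by (simp add: core_reflection_def)
  next
    case True
    have no_rem: "\<not> rem k" if "int e dvd k - int i" for k
    proof
      assume r: "rem k"
      define p where "p = nat (t k - 1)"
      define q where "q = nat (int p + k)"
      have "t k \<ge> 1" "t k - 1 + k \<ge> 0"
        using ground_le_profile[OF prof, of "k + 1"] ground_le_profile[OF prof, of "k - 1"] r unfolding rem_def by (auto simp: ground_def)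
      then have "int p + 1 = t k" "int q - int p = k" by (auto simp: p_def q_def)
      then have "(p, q) \<in> removable e i (diagram_of t)" using r that unfolding removable by simp
      then show False using True by simp
    qed
    then have "(i', j') \<in> diagram_of t \<union> addable e i (diagram_of t) \<longleftrightarrow>
        (i', j') \<in> diagram_of (reflect e i t)" for i' j'
      unfolding Un_iff addable mem_diagram_of reflected by auto
    then have "diagram_of t \<union> addable e i (diagram_of t) = diagram_of (reflect e i t)" by auto
    then show ?thesis using True by (auto simp: core_reflection_def)
  qed
qed

lemma core_profile_word:
  assumes "core_profile e t" "e \<ge> 2"
  shows "core_profile e (foldr (reflect e) w t)"
  using assms by (induction w) (auto intro: core_profile_reflect)

lemma act_core_diagram_of:
  assumes "core_profile e t" "e \<ge> 2" "set w \<subseteq> {..<e}"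
  shows "act_core e w (diagram_of t) = diagram_of (foldr (reflect e) w t)"
  using assms(3)
  by (induction w)
    (use assms(1,2) in \<open>auto simp: act_core_def core_reflection_diagram_of core_profile_word\<close>)

lemma reflect_involution:
  assumes "e \<ge> 2"
  shows "reflect e i (reflect e i t) = t"
proof
  fix k
  have "\<not> int e dvd k + 1 - int i" "\<not> int e dvd k - 1 - int i" if "int e dvd k - int i"
    using not_dvd_neighbours[OF assms that] .
  then show "reflect e i (reflect e i t) k = t k" by (simp add: reflect_def)
qed

text \<open>
  The hypothesis says that \<open>i < j\<close> are not neighbours in the cycle of residues modulo \<open>e\<close>.
\<close>
lemma reflect_commute:
  assumes "i + 1 < j" "j + 1 < i + e"
  shows "reflect e i (reflect e j t) = reflect e j (reflect e i t)"
proof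
  fix k
  have *: "\<not> int e dvd int j - int i - 1" "\<not> int e dvd int j - int i + 1"
    using assms zdvd_not_zless[of "int j - int i - 1" "int e"]
      zdvd_not_zless[of "int j - int i + 1" "int e"] by auto
  have 1: "\<not> (int e dvd k - int i \<and> int e dvd k + 1 - int j)"
    using *(1) not_both_dvd[of "int e" "k - int i" "k + 1 - int j"] by (auto simp: algebra_simps)
  have 2: "\<not> (int e dvd k - int i \<and> int e dvd k - 1 - int j)"
    using *(2) not_both_dvd[of "int e" "k - int i" "k - 1 - int j"] by (auto simp: algebra_simps)
  have 3: "\<not> (int e dvd k - int j \<and> int e dvd k + 1 - int i)"
    using *(2) not_both_dvd[of "int e" "k + 1 - int i" "k - int j"] by (auto simp: algebra_simps)
  have 4: "\<not> (int e dvd k - int j \<and> int e dvd k - 1 - int i)"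
    using *(1) not_both_dvd[of "int e" "k - 1 - int i" "k - int j"] by (auto simp: algebra_simps)
  show "reflect e i (reflect e j t) k = reflect e j (reflect e i t) k"
    using 1 2 3 4 by (auto simp: reflect_def)
qed

section \<open>Self-conjugate cores form one orbit of type $D^{(2)}_{n+1}$\<close>

inductive_set orbit :: "dtype \<Rightarrow> nat \<Rightarrow> profile set" for X n where
  ground: "ground \<in> orbit X n"
| step: "t \<in> orbit X n \<Longrightarrow> u \<le> n \<Longrightarrow> foldr (reflect (2 * n)) (generator X n u) t \<in> orbit X n"

lemma orbit_word:
  assumes "t \<in> orbit X n"
  shows "\<exists>w \<in> weyl_words X n. t = foldr (reflect (2 * n)) w ground"
  using assms
proof induction
  case ground
  have "[] \<in> weyl_words X n" 
    unfolding weyl_words_def by (force intro!: exI[of _ "[]"])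
  then show ?case by force
next
  case (step t u)
  then obtain us where us: "set us \<subseteq> {0..n}"
      "t = foldr (reflect (2 * n)) (concat (map (generator X n) us)) ground"
    by (auto simp: weyl_words_def)
  have "concat (map (generator X n) (u # us)) \<in> weyl_words X n"
    unfolding weyl_words_def using us(1) step(2) by (force intro!: exI[of _ "u # us"])
  moreover have "foldr (reflect (2 * n)) (generator X n u) t =
      foldr (reflect (2 * n)) (concat (map (generator X n) (u # us))) ground"
    by (simp add: us(2))
  ultimately show ?case by blast
qed

lemma generator_letters:
  assumes "n \<ge> 2" "u \<le> n"
  shows "set (generator X n u) \<subseteq> {..<2 * n}"
  using assms by (cases X) auto

lemma weyl_word_letters:
  assumes "n \<ge> 2" "w \<in> weyl_words X n"
  shows "set w \<subseteq> {..<2 * n}"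
  using generator_letters[OF assms(1), of _ X] assms(2) by (fastforce simp: weyl_words_def)

lemma self_conjugate_neighbours:
  assumes "self_conjugate t"
  shows "t (- k) = t k + k" "t (- k - 1) = t (k + 1) + k + 1" "t (- k + 1) = t (k - 1) + k - 1"
proof -
  have *: "t l = t (- l) - l" for l using assms unfolding self_conjugate_def by blast
  show "t (- k) = t k + k" using *[of k] by simp
  show "t (- k - 1) = t (k + 1) + k + 1" using *[of "k + 1"] by simp
  show "t (- k + 1) = t (k - 1) + k - 1" using *[of "k - 1"] by simp
qed

lemma self_conjugateI:
  assumes "\<And>k. t (- k) = t k + k"
  shows "self_conjugate t"
  unfolding self_conjugate_def using assms by simp

lemma self_conjugate_reflect:
  assumes t: "self_conjugate t" and i: "int e dvd 2 * int i"
  shows "self_conjugate (reflect e i t)"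
proof (rule self_conjugateI)
  fix k
  have eq: "- k - int i = - (k - int i + 2 * int i)" by simp
  have "int e dvd - k - int i \<longleftrightarrow> int e dvd k - int i"
    unfolding eq dvd_minus_iff using i by (rule dvd_add_left_iff)
  then show "reflect e i t (- k) = reflect e i t k + k"
    using self_conjugate_neighbours[OF t, of k] by (simp add: reflect_def)
qed

text \<open>
  Residues \<open>i\<close> and \<open>- i\<close> modulo \<open>2 n\<close> differ by an even number, hence are not adjacent, and both
  factors may be applied at once. The resulting formula is visibly invariant under \<open>k \<mapsto> - k\<close>.
\<close>
lemma reflect_pair:
  assumes "i < n" "0 < i"
  shows "reflect (2 * n) i (reflect (2 * n) (2 * n - i) t) =
    (\<lambda>k. if int (2 * n) dvd k - int i \<or> int (2 * n) dvd k + int i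
       then t (k - 1) + t (k + 1) - t k else t k)"
proof
  fix k
  have conv: "int (2 * n) dvd m - int (2 * n - i) \<longleftrightarrow> int (2 * n) dvd m + int i" for m
  proof -
    have eq: "m - int (2 * n - i) = (m + int i) - int (2 * n)" using assms by (simp add: of_nat_diff)
    show ?thesis unfolding eq dvd_eq_mod_eq_0 by simp
  qed
  \<comment> \<open>by parity: \<open>m\<close> and \<open>k - i\<close> differ by an odd number\<close>
  have odd: "\<not> (int (2 * n) dvd k - int i \<and> int (2 * n) dvd m)"
    if "m = k + 1 + int i \<or> m = k - 1 + int i" for m
  proof
    assume "int (2 * n) dvd k - int i \<and> int (2 * n) dvd m"
    moreover have "even c" if "int (2 * n) dvd c" for c :: int
      using dvd_trans[OF _ that, of 2] by simp
    ultimately have "even (k - int i)" "even m" by blast+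
    then show False using that by presburger
  qed
  have both: "\<not> (int (2 * n) dvd k - int i \<and> int (2 * n) dvd k + int i)"
  proof
    assume "int (2 * n) dvd k - int i \<and> int (2 * n) dvd k + int i"
    then have "int (2 * n) dvd (k + int i) - (k - int i)" by (blast intro: dvd_diff)
    then have "int (2 * n) dvd 2 * int i" by simp
    then show False using assms zdvd_not_zless[of "2 * int i" "int (2 * n)"] by simp
  qed
  show "reflect (2 * n) i (reflect (2 * n) (2 * n - i) t) k =
    (if int (2 * n) dvd k - int i \<or> int (2 * n) dvd k + int i
       then t (k - 1) + t (k + 1) - t k else t k)"
    using odd[of "k + 1 + int i"] odd[of "k - 1 + int i"] both
    by (cases "int (2 * n) dvd k - int i"; cases "int (2 * n) dvd k + int i")
      (auto simp only: reflect_def conv simp_thms if_True if_False)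
qed

lemma self_conjugate_reflect_pair:
  assumes t: "self_conjugate t" and i: "0 < i" "i < n"
  shows "self_conjugate (reflect (2 * n) i (reflect (2 * n) (2 * n - i) t))"
  unfolding reflect_pair[OF i(2,1)]
proof (rule self_conjugateI)
  fix k
  have "int (2 * n) dvd - k - int i \<longleftrightarrow> int (2 * n) dvd k + int i"
    using dvd_minus_iff[of "int (2 * n)" "k + int i"] by (simp only: minus_add_distrib diff_conv_add_uminus)
  moreover have "int (2 * n) dvd - k + int i \<longleftrightarrow> int (2 * n) dvd k - int i"
    using dvd_minus_iff[of "int (2 * n)" "k - int i"] by (simp only: minus_diff_eq uminus_add_conv_diff)
  ultimately show "(if int (2 * n) dvd - k - int i \<or> int (2 * n) dvd - k + int i
      then t (- k - 1) + t (- k + 1) - t (- k) else t (- k)) =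
    (if int (2 * n) dvd k - int i \<or> int (2 * n) dvd k + int i
      then t (k - 1) + t (k + 1) - t k else t k) + k"
    using self_conjugate_neighbours[OF t, of k] by auto
qed

lemma D2_generator_preserves:
  assumes "n \<ge> 2" "u \<le> n" "self_conjugate t" 
  shows "self_conjugate (foldr (reflect (2 * n)) (generator D2 n u) t)"
  using self_conjugate_reflect[OF assms(3)] self_conjugate_reflect_pair[OF assms(3)] assms(1,2)
  by auto

lemma D2_generator_involution:
  assumes "n \<ge> 2" "u \<le> n"
  shows "foldr (reflect (2 * n)) (generator D2 n u)
     (foldr (reflect (2 * n)) (generator D2 n u) t) = t"
proof -
  have inv: "reflect (2 * n) i (reflect (2 * n) i t) = t" for i t
    using reflect_involution[of "2 * n" i t] assms by simp
  have "reflect (2 * n) u (reflect (2 * n) (2 * n - u) t) =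
      reflect (2 * n) (2 * n - u) (reflect (2 * n) u t)" if "u \<noteq> 0" "u \<noteq> n" for t
    using reflect_commute[of u "2 * n - u" "2 * n" t] that assms by simp
  then show ?thesis by (auto simp: inv)
qed

text \<open>
  A box with maximal sum of coordinates has no right and no lower neighbour.
\<close>
lemma removable_corner_exists:
  assumes t: "is_profile t" and "t \<noteq> ground"
  obtains k where "t (k - 1) = t k" "t (k + 1) = t k - 1"
proof -
  have ne: "diagram_of t \<noteq> {}"
    using diagram_of_inject[OF t is_profile_ground] assms(2) diagram_of_ground by auto
  define f where "f = (\<lambda>(i, j). i + j :: nat)"
  have "finite (f ` diagram_of t)" "f ` diagram_of t \<noteq> {}"
    using finite_diagram_of[OF t] ne by auto
  then have "Max (f ` diagram_of t) \<in> f ` diagram_of t" by (rule Max_in)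
  then obtain p q where pq: "(p, q) \<in> diagram_of t" "p + q = Max (f ` diagram_of t)"
    by (auto simp: f_def)
  have max: "i + j \<le> p + q" if "(i, j) \<in> diagram_of t" for i j
    using Max_ge[OF \<open>finite (f ` diagram_of t)\<close>, of "f (i, j)"] that pq(2) by (auto simp: f_def)
  have "(p + 1, q) \<notin> diagram_of t" "(p, q + 1) \<notin> diagram_of t"
    using max[of "p + 1" q] max[of p "q + 1"] by auto
  then show thesis
    using that[of "int q - int p"] pq(1) profile_step[OF t, of "int q - int p"]
    by (auto simp: mem_diagram_of algebra_simps)
qed

lemma core_removable_residue:
  assumes t: "core_profile e t" and "int e dvd k - m"
    and rem: "t (k - 1) = t k" "t (k + 1) = t k - 1"
  shows "t (m - 1) + t (m + 1) - t m \<le> t m"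
  using core_not_addable_and_removable[OF assms] profile_step[OF core_profile_imp_profile[OF t], of m]
  by linarith

lemma diagram_of_strict_mono:
  assumes "is_profile t" "\<And>k. t' k \<le> t k" "t' \<noteq> t" "is_profile t'"
  shows "diagram_of t' \<subset> diagram_of t"
proof -
  have "diagram_of t' \<subseteq> diagram_of t"
    using assms(2) by (force simp: diagram_of_def intro: less_le_trans)
  moreover have "diagram_of t' \<noteq> diagram_of t" using diagram_of_inject assms by blast
  ultimately show ?thesis by blast
qed

text \<open>
  A nonempty core has a removable box, of residue \<open>i\<close> say. By symmetry there is also one of residue
  \<open>- i\<close>, and since a core has no addable box of these residues, the generator of index \<open>i\<close> or
  \<open>2 n - i\<close> strictly shrinks the diagram. Generators are involutions, so the core is obtained
  from a smaller one.
\<close>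
lemma core_in_orbit_D2:
  assumes n: "n \<ge> 2" and "core_profile (2 * n) t" "self_conjugate t"
  shows "t \<in> orbit D2 n"
  using assms(2,3)
proof (induction "card (diagram_of t)" arbitrary: t rule: less_induct)
  case less
  note t = \<open>core_profile (2 * n) t\<close> and sc = \<open>self_conjugate t\<close>
  have prof: "is_profile t" using core_profile_imp_profile[OF t] .
  show ?case
  proof (cases "t = ground")
    case True
    then show ?thesis by (simp add: orbit.ground)
  next
    case False
    obtain k where k: "t (k - 1) = t k" "t (k + 1) = t k - 1"
      using removable_corner_exists[OF prof False] by blast
    define i where "i = nat (k mod int (2 * n))"
    have i: "i < 2 * n" "int (2 * n) dvd k - int i"
      using n by (auto simp: i_def nat_less_iff)
    define u where "u = (if i \<le> n then i else 2 * n - i)"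
    define s where "s = foldr (reflect (2 * n)) (generator D2 n u) t"
    have u: "u \<le> n" using i(1) by (auto simp: u_def)
    have res: "t (m - 1) + t (m + 1) - t m \<le> t m" if "int (2 * n) dvd m - int i" for m
    proof -
      have "int (2 * n) dvd (k - int i) - (m - int i)" using i(2) that by (rule dvd_diff)
      then show ?thesis using core_removable_residue[OF t _ k, of m] by simp
    qed
    have res': "t (m - 1) + t (m + 1) - t m \<le> t m" if "int (2 * n) dvd m + int i" for m
    proof -
      have "int (2 * n) dvd - m - int i" 
        using that dvd_minus_iff[of "int (2 * n)" "m + int i"]
        by (simp only: minus_add_distrib diff_conv_add_uminus)
      then show ?thesis using res[of "- m"] self_conjugate_neighbours[OF sc, of m] by simp
    qed
    have s_val: "s m = (if int (2 * n) dvd m - int i \<or> int (2 * n) dvd m + int i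
       then t (m - 1) + t (m + 1) - t m else t m)" for m
    proof -
      consider "i = 0" | "i = n" | "0 < i" "i < n" | "n < i" by linarith
      then show ?thesis
      proof cases
        case 1
        then show ?thesis by (simp add: s_def u_def reflect_def)
      next
        case 2
        have eq: "m + int n = (m - int n) + int (2 * n)" by simp
        have "int (2 * n) dvd m + int n \<longleftrightarrow> int (2 * n) dvd m - int n"
          unfolding eq by (simp only: dvd_add_left_iff[OF dvd_refl])
        then show ?thesis using 2 n by (simp add: s_def u_def reflect_def)
      next
        case 3
        then show ?thesis using reflect_pair[OF 3(2,1), of t] by (simp add: s_def u_def)
      next
        case 4
        have eq: "m + int i = (m - int (2 * n - i)) + int (2 * n)"
          "m + int (2 * n - i) = (m - int i) + int (2 * n)" using i(1) by (auto simp: of_nat_diff)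
        have "int (2 * n) dvd m + int i \<longleftrightarrow> int (2 * n) dvd m - int (2 * n - i)"
          "int (2 * n) dvd m + int (2 * n - i) \<longleftrightarrow> int (2 * n) dvd m - int i"
          unfolding eq by (simp_all only: dvd_add_left_iff[OF dvd_refl])
        then show ?thesis using reflect_pair[of "2 * n - i" n t] 4 i(1)
          by (auto simp: s_def u_def)
      qed
    qed
    have "s m \<le> t m" for m using res[of m] res'[of m] by (auto simp: s_val)
    moreover have "s \<noteq> t" 
    proof
      assume "s = t"
      then have "s k = t k" by simp
      then show False using i(2) k by (simp add: s_val)
    qed
    moreover have core: "core_profile (2 * n) s"
      unfolding s_def using core_profile_word[OF t] n by simp
    ultimately have "diagram_of s \<subset> diagram_of t"
      using diagram_of_strict_mono[OF prof] core_profile_imp_profile by blast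
    then have "card (diagram_of s) < card (diagram_of t)"
      using finite_diagram_of[OF prof] by (simp add: psubset_card_mono)
    then have "s \<in> orbit D2 n"
      using less.hyps core D2_generator_preserves[OF n u sc] by (simp add: s_def)
    then have "foldr (reflect (2 * n)) (generator D2 n u) s \<in> orbit D2 n"
      using u by (rule orbit.step)
    then show ?thesis unfolding s_def D2_generator_involution[OF n u] .
  qed
qed

section \<open>Even self-conjugate cores form one orbit of type $D^{(1)}_n$\<close>

lemma reflect_ground:
  assumes "0 < i" "i < e"
  shows "reflect e i ground = ground"
proof
  fix k
  have "\<not> int e dvd - int i" using assms zdvd_not_zless[of "int i" "int e"] by simp
  then show "reflect e i ground k = ground k"
    by (cases "k = 0") (auto simp: reflect_def ground_def)
qed

text \<open>
  Conjugation by \<open>s\<^sub>n\<close> permutes the generators of type $D^{(1)}_n$: it exchanges those of index \<open>n - 1\<close>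
  and \<open>n\<close> and fixes the others. Since \<open>s\<^sub>n\<close> fixes the empty core, it maps the orbit to itself.
\<close>
lemma orbit_D1_reflect_n:
  assumes n: "n \<ge> 4" and "t \<in> orbit D1 n"
  shows "reflect (2 * n) n t \<in> orbit D1 n"
  using assms(2)
proof induction
  case ground
  show ?case using n by (simp add: reflect_ground orbit.ground)
next
  case (step t u)
  let ?s = "reflect (2 * n)"
  have gen: "foldr ?s (generator D1 n v) (?s n t) \<in> orbit D1 n" if "v \<le> n" for v
    using step.IH that by (rule orbit.step)
  have inv: "?s i (?s i t) = t" for i t using reflect_involution[of "2 * n" i t] n by simp
  have commute: "?s n (?s i t) = ?s i (?s n t)" if "i + 1 < n \<or> n + 1 < i" "i < 2 * n" for i t
    using reflect_commute[of i n "2 * n" t] reflect_commute[of n i "2 * n" t] that n by auto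
  consider "u = 0" | "0 < u" "u + 1 < n" | "u + 1 = n" | "u = n" using step.hyps by linarith
  then show ?case
  proof cases
    case 1
    then show ?thesis using gen[of 0] n by (simp add: commute)
  next
    case 2
    then have "Suc n < 2 * n - u" by linarith
    then show ?thesis using gen[of u] commute[of u] commute[of "2 * n - u"] 2 n by simp
  next
    case 3
    then have u: "u = n - 1" "2 * n - u = n + 1" "n - 1 \<noteq> 0" "n - 1 \<noteq> n" using n by auto
    then show ?thesis using gen[of n] n by (simp add: inv)
  next
    case 4
    have "generator D1 n (n - 1) = [n - 1, n + 1]" using n by auto
    then show ?thesis using gen[of "n - 1"] n 4 by (simp add: inv)
  qed
qed

text \<open>
  The union of the orbit with its image under \<open>s\<^sub>0\<close> is stable under all generators of type
  $D^{(2)}_{n+1}$: conjugation by \<open>s\<^sub>0\<close> exchanges the $D^{(1)}_n$ generators of index 0 and 1 and fixes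
  the others, and \<open>s\<^sub>n\<close> commutes with \<open>s\<^sub>0\<close>.
\<close>
lemma orbit_D2_cosets:
  assumes n: "n \<ge> 4" and "t \<in> orbit D2 n"
  shows "t \<in> orbit D1 n \<or> reflect (2 * n) 0 t \<in> orbit D1 n"
  using assms(2)
proof induction
  case ground
  show ?case by (simp add: orbit.ground)
next
  case (step t u)
  let ?s = "reflect (2 * n)"
  have inv: "?s i (?s i t) = t" for i t using reflect_involution[of "2 * n" i t] n by simp
  have commute: "?s 0 (?s i t) = ?s i (?s 0 t)" if "1 < i" "i + 1 < 2 * n" for i t
    using reflect_commute[of 0 i "2 * n" t] that by simp
  have gen: "foldr ?s (generator D1 n v) t \<in> orbit D1 n" if "v \<le> n" "t \<in> orbit D1 n" for v t
    using that by (blast intro: orbit.step)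
  consider "u = 0" | "u = 1" | "1 < u" "u < n" | "u = n" using step.hyps by linarith
  then show ?case
  proof cases
    case 1
    then show ?thesis using step.IH by (auto simp: inv)
  next
    case 2
    from step.IH show ?thesis
    proof
      assume "t \<in> orbit D1 n"
      then show ?thesis using gen[of 1 t] 2 n by simp
    next
      assume "?s 0 t \<in> orbit D1 n"
      then show ?thesis using gen[of 0 "?s 0 t"] 2 n by (simp add: inv)
    qed
  next
    case 3
    from step.IH show ?thesis
    proof
      assume "t \<in> orbit D1 n"
      then show ?thesis using gen[of u t] 3 n by simp
    next
      assume "?s 0 t \<in> orbit D1 n"
      then show ?thesis using gen[of u "?s 0 t"] 3 n by (simp add: commute)
    qed
  next
    case 4
    then show ?thesis
      using step.IH orbit_D1_reflect_n[OF n, of t] orbit_D1_reflect_n[OF n, of "?s 0 t"] n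
      by (auto simp: commute)
  qed
qed

text \<open>
  Only the boundary steps next to content 0 matter, and symmetry makes them opposite to each
  other. Hence \<open>s\<^sub>0\<close> always adds or removes a box of the main diagonal, and so changes the parity of
  the length \<open>t 0\<close> of the diagonal.
\<close>
lemma reflect_0_diagonal:
  assumes "self_conjugate t"
  shows "reflect e 0 t 0 = 2 * t 1 + 1 - t 0"
  using self_conjugate_neighbours(1)[OF assms, of 1] by (simp add: reflect_def)

lemma reflect_diagonal:
  assumes "0 < i" "i < e"
  shows "reflect e i t 0 = t 0"
  using assms zdvd_not_zless[of "int i" "int e"] by (simp add: reflect_def)

lemma orbit_D1_even:
  assumes n: "n \<ge> 4" and "t \<in> orbit D1 n"
  shows "self_conjugate t \<and> even (t 0)"
  using assms(2)
proof induction
  case ground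
  show ?case using self_conjugate_ground by (simp add: ground_def[of 0])
next
  case (step t u)
  let ?s = "reflect (2 * n)"
  have sc: "self_conjugate t" and even: "even (t 0)" using step.IH by auto
  have s0: "self_conjugate (?s 0 t)" if "self_conjugate t" for t
    using self_conjugate_reflect[OF that, of "2 * n" 0] by simp
  have sn: "self_conjugate (?s n t)" if "self_conjugate t" for t
    using self_conjugate_reflect[OF that, of "2 * n" n] by simp
  have si: "self_conjugate (?s i (?s (2 * n - i) t))" if "self_conjugate t" "0 < i" "i < n" for t i
    using self_conjugate_reflect_pair[OF that] .
  have diag: "?s i t 0 = t 0" if "0 < i" "i < 2 * n" for i t
    using reflect_diagonal[OF that] .
  consider "u = 0" | "0 < u" "u < n" | "u = n" using step.hyps by linarith
  then show ?case
  proof cases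
    case 1
    have "2 * n - 1 < 2 * n" "0 < 2 * n - 1" using n by auto
    then have "even (?s 0 (?s 1 (?s (2 * n - 1) (?s 0 t))) 0)"
      using reflect_0_diagonal[OF si[OF s0[OF sc], of 1], of "2 * n"]
        reflect_0_diagonal[OF sc, of "2 * n"] even n by (simp add: diag)
    then show ?thesis using 1 s0[OF si[OF s0[OF sc], of 1]] n by simp
  next
    case 2
    then show ?thesis using si[OF sc, of u] even n by (simp add: diag)
  next
    case 3
    have "2 * n - (n - 1) = n + 1" using n by simp
    then show ?thesis using 3 sn[OF si[OF sn[OF sc], of "n - 1"]] even n by (simp add: diag)
  qed
qed

lemma even_core_in_orbit_D1:
  assumes n: "n \<ge> 4" and t: "core_profile (2 * n) t" "self_conjugate t" and "even (t 0)"
  shows "t \<in> orbit D1 n"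
proof (rule ccontr)
  assume "t \<notin> orbit D1 n"
  then have "reflect (2 * n) 0 t \<in> orbit D1 n"
    using orbit_D2_cosets[OF n core_in_orbit_D2[OF _ t]] n by simp
  then have "even (reflect (2 * n) 0 t 0)" using orbit_D1_even[OF n] by blast
  then show False using reflect_0_diagonal[OF t(2)] assms(4) by simp
qed

section \<open>Residue counts and weights\<close>

text \<open>
  For a profile, the number of boxes whose content is congruent to \<open>j\<close> modulo \<open>e\<close>. The restriction to
  the support of \<open>t - ground\<close> makes the sum finite. The index is an integer, so that \<open>- j\<close> and
  \<open>j + 1\<close> need no reduction modulo \<open>e\<close>.
\<close>
definition content_count :: "nat \<Rightarrow> profile \<Rightarrow> int \<Rightarrow> int" where
  "content_count e t j = (\<Sum>k | int e dvd k - j \<and> t k \<noteq> ground k. t k - ground k)"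

lemma finite_support:
  assumes "is_profile t"
  shows "finite {k. P k \<and> t k \<noteq> ground k}"
proof -
  obtain N where "\<And>k. N \<le> \<bar>k\<bar> \<Longrightarrow> t k = ground k"
    using profile_eventually_ground[OF assms] by blast
  then have "{k. P k \<and> t k \<noteq> ground k} \<subseteq> {- N..N}" by force
  then show ?thesis by (rule finite_subset) simp
qed

lemma content_count_superset:
  assumes "finite A" "\<And>k. k \<notin> A \<Longrightarrow> t k = ground k"
  shows "content_count e t j = (\<Sum>k\<in>A. if int e dvd k - j then t k - ground k else 0)"
proof -
  have "content_count e t j = (\<Sum>k | k \<in> A \<and> int e dvd k - j. t k - ground k)"
    unfolding content_count_def using assms by (intro sum.mono_neutral_left) auto
  then show ?thesis using assms(1) by (simp add: sum.inter_filter)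
qed

lemma content_count_cong:
  assumes "int e dvd i - j"
  shows "content_count e t i = content_count e t j"
proof -
  have "int e dvd k - i \<longleftrightarrow> int e dvd k - j" for k
  proof -
    have eq: "k - j = (k - i) + (i - j)" by simp
    show ?thesis unfolding eq using dvd_add_left_iff[OF assms] by blast
  qed
  then show ?thesis by (simp add: content_count_def)
qed

lemma content_count_reflect_other:
  assumes "i < e" "j < e" "i \<noteq> j"
  shows "content_count e (reflect e i t) (int j) = content_count e t (int j)"
proof -
  have "\<not> int e dvd k - int i" if "int e dvd k - int j" for k
  proof -
    have "\<not> int e dvd (k - int i) - (k - int j)"
      using assms zdvd_not_zless[of "int j - int i" "int e"] zdvd_not_zless[of "int i - int j" "int e"]
        dvd_diff_commute[of "int e" "int i" "int j"] by (cases "i < j") auto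
    then show ?thesis using not_both_dvd that by blast
  qed
  then have "reflect e i t k = t k" if "int e dvd k - int j" for k
    using that by (simp add: reflect_def)
  then show ?thesis unfolding content_count_def by (intro sum.cong) auto
qed

text \<open>
  This is the formula for \<open>reflect\<close> summed over a residue class. The term 1 comes from the corner of
  \<open>ground\<close> at content 0, where its second difference is 1 instead of 0.
\<close>
lemma content_count_reflect_same:
  assumes t: "is_profile t" and i: "i < e"
  shows "content_count e (reflect e i t) (int i) =
    content_count e t (int i - 1) + content_count e t (int i + 1) - content_count e t (int i)
      + (if i = 0 then 1 else 0)"
proof -
  obtain N where N: "N > 0" "\<And>k. N \<le> \<bar>k\<bar> \<Longrightarrow> t k = ground k"
    using profile_eventually_ground[OF t] by blast
  \<comment> \<open>wide enough to contain the support after shifting by one and after reflecting\<close>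
  define A where "A = {- N - 1..N + 1}"
  let ?P = "\<lambda>k. int e dvd k - int i"
  let ?d = "\<lambda>k. t k - ground k"
  have outside: "t k = ground k" if "\<not> (- N \<le> k \<and> k \<le> N)" for k
    using that N by (intro N(2)) auto
  have out: "reflect e i t k = ground k" if "k \<notin> A" for k
  proof -
    have "t k = ground k" "t (k - 1) = ground (k - 1)" "t (k + 1) = ground (k + 1)"
      using that by (intro outside; auto simp: A_def)+
    then show ?thesis using that N(1) by (auto simp: A_def reflect_def ground_def)
  qed
  have up: "content_count e t (int i + 1) = (\<Sum>k\<in>A. if ?P k then ?d (k + 1) else 0)"
  proof -
    have "content_count e t (int i + 1) =
        (\<Sum>k\<in>{- N..N + 2}. if int e dvd k - (int i + 1) then ?d k else 0)"
      by (rule content_count_superset) (use outside in auto)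
    also have "\<dots> = (\<Sum>k\<in>A. if ?P k then ?d (k + 1) else 0)"
      by (rule sum.reindex_bij_witness[of _ "\<lambda>k. k + 1" "\<lambda>k. k - 1"])
        (auto simp: A_def algebra_simps)
    finally show ?thesis .
  qed
  have down: "content_count e t (int i - 1) = (\<Sum>k\<in>A. if ?P k then ?d (k - 1) else 0)"
  proof -
    have "content_count e t (int i - 1) =
        (\<Sum>k\<in>{- N - 2..N}. if int e dvd k - (int i - 1) then ?d k else 0)"
      by (rule content_count_superset) (use outside in auto)
    also have "\<dots> = (\<Sum>k\<in>A. if ?P k then ?d (k - 1) else 0)"
      by (rule sum.reindex_bij_witness[of _ "\<lambda>k. k - 1" "\<lambda>k. k + 1"])
        (auto simp: A_def algebra_simps)
    finally show ?thesis .
  qed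
  have mid: "content_count e t (int i) = (\<Sum>k\<in>A. if ?P k then ?d k else 0)"
    by (rule content_count_superset) (use outside in \<open>auto simp: A_def\<close>)
  have zero: "(if i = 0 then 1 else 0) = (\<Sum>k\<in>A. if k = 0 then (if ?P k then 1 else 0) else (0::int))"
  proof -
    have "int e dvd - int i \<longleftrightarrow> i = 0" using i zdvd_not_zless[of "int i" "int e"] by auto
    then show ?thesis using N(1) by (simp add: A_def)
  qed
  have "content_count e (reflect e i t) (int i) =
      (\<Sum>k\<in>A. if ?P k then reflect e i t k - ground k else 0)"
    by (rule content_count_superset) (use out in \<open>auto simp: A_def\<close>)
  also have "\<dots> = (\<Sum>k\<in>A. (if ?P k then ?d (k - 1) else 0) + (if ?P k then ?d (k + 1) else 0)
      - (if ?P k then ?d k else 0) + (if k = 0 then (if ?P k then 1 else 0) else 0))"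
    by (intro sum.cong) (auto simp: reflect_def ground_def)
  finally show ?thesis unfolding up down mid zero by (simp only: sum.distrib sum_subtractf)
qed

lemma residue_count_diagram_of:
  assumes t: "is_profile t" and "j < e"
  shows "int (residue_count e j (diagram_of t)) = content_count e t (int j)"
proof -
  define S where "S = {k. int e dvd k - int j \<and> t k \<noteq> ground k}"
  define f where "f = (\<lambda>(p, q). (int q - int p, int p))"
  have "f ` {b \<in> diagram_of t. residue e b = j} = (SIGMA k:S. {ground k..<t k})"
  proof (intro set_eqI iffI)
    fix x assume "x \<in> f ` {b \<in> diagram_of t. residue e b = j}"
    then obtain p q where "x = (int q - int p, int p)" "(p, q) \<in> diagram_of t" "residue e (p, q) = j"
      by (auto simp: f_def)
    then show "x \<in> (SIGMA k:S. {ground k..<t k})"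
      using residue_eq_iff[OF assms(2)] by (auto simp: mem_diagram_of S_def ground_def)
  next
    fix x assume "x \<in> (SIGMA k:S. {ground k..<t k})"
    then obtain k l where x: "x = (k, l)" "k \<in> S" "ground k \<le> l" "l < t k" by auto
    define p where "p = nat l"
    define q where "q = nat (l + k)"
    have pq: "int p = l" "int q - int p = k" using x(3) by (auto simp: p_def q_def ground_def)
    then have "(p, q) \<in> diagram_of t" "residue e (p, q) = j"
      using x residue_eq_iff[OF assms(2)] by (auto simp: mem_diagram_of S_def)
    moreover have "x = f (p, q)" using pq x by (simp add: f_def)
    ultimately show "x \<in> f ` {b \<in> diagram_of t. residue e b = j}" by blast
  qed
  moreover have "inj_on f {b \<in> diagram_of t. residue e b = j}"
    by (auto simp: f_def inj_on_def)
  ultimately have "residue_count e j (diagram_of t) = card (SIGMA k:S. {ground k..<t k})"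
    unfolding residue_count_def by (metis card_image)
  also have "\<dots> = (\<Sum>k\<in>S. card {ground k..<t k})"
    by (rule card_SigmaI) (auto simp: S_def finite_support[OF t])
  finally show ?thesis
    using ground_le_profile[OF t] by (simp add: content_count_def S_def)
qed

lemma content_count_self_conjugate:
  assumes "self_conjugate t"
  shows "content_count e t (- j) = content_count e t j"
proof -
  have t: "t (- k) = t k + k" for k using self_conjugate_neighbours(1)[OF assms] .
  have g: "ground (- k) = ground k + k" for k by (simp add: ground_def)
  have neg: "int e dvd - k + j \<longleftrightarrow> int e dvd k - j" for k
    using dvd_minus_iff[of "int e" "k - j"] by simp
  have neg': "int e dvd - k - j \<longleftrightarrow> int e dvd k + j" for k
    using dvd_minus_iff[of "int e" "k + j"] by simp
  show ?thesis unfolding content_count_def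
    by (rule sum.reindex_bij_witness[of _ uminus uminus])
      (auto simp: t g neg neg' dvd_diff_commute[of "int e" j])
qed

lemma scale_add_left: "scale (a + b) v = scale a v + scale b v"
  by (simp add: scale_def prod_eq_iff fun_eq_iff algebra_simps)

lemma scale_add_right: "scale a (v + w) = scale a v + scale a w"
  by (simp add: scale_def prod_eq_iff fun_eq_iff algebra_simps)

lemma scale_scale: "scale a (scale b v) = scale (a * b) v"
  by (simp add: scale_def mult.assoc)

lemma scale_zero: "scale 0 v = 0"
  by (simp add: scale_def prod_eq_iff fun_eq_iff)

lemma sum_apply: "(\<Sum>i\<in>A. f i) x = (\<Sum>i\<in>A. f i x)"
  for f :: "'a \<Rightarrow> 'b \<Rightarrow> 'c::comm_monoid_add"
  by (induction A rule: infinite_finite_induct) auto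

lemma cartan_row:
  assumes "e \<ge> 3" "i < e"
  shows "(\<Sum>j<e. a j * cartan e i j) = 2 * a i - a ((i + 1) mod e) - a ((i + e - 1) mod e)"
proof -
  have pred: "i = (j + 1) mod e \<longleftrightarrow> j = (i + e - 1) mod e" if "j < e" for j
    using assms that by (cases "j + 1 = e"; cases "i = 0") (auto simp: mod_if)
  have ne: "(i + 1) mod e \<noteq> i" "(i + e - 1) mod e \<noteq> i" "(i + 1) mod e \<noteq> (i + e - 1) mod e"
    using assms by (cases "i + 1 = e"; cases "i = 0"; auto simp: mod_if)+
  have "(\<Sum>j<e. a j * cartan e i j) = (\<Sum>j<e. (if j = i then 2 * a j else 0)
      - (if j = (i + 1) mod e then a j else 0) - (if j = (i + e - 1) mod e then a j else 0))"
    using ne pred by (intro sum.cong) (auto simp: cartan_def)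
  then show ?thesis using assms by (simp add: sum_subtractf)
qed

lemma root_combination_apply:
  assumes "e \<ge> 3" "i < e"
  shows "fst (\<Sum>j<e. scale (a j) (simple_root e j)) i
    = 2 * a i - a ((i + 1) mod e) - a ((i + e - 1) mod e)"
  unfolding cartan_row[OF assms, symmetric]
  using assms by (simp add: fst_sum sum_apply scale_def simple_root_def)

text \<open>
  A relation between the simple roots has coefficients with vanishing second differences around the
  cycle, so they are proportional to the index; the component of the null root gives \<open>c 0 = 0\<close>, and
  closing the cycle gives \<open>e * c 1 = 0\<close>.
\<close>
lemma simple_roots_independent:
  assumes e: "e \<ge> 3"
    and eq: "(\<Sum>j<e. scale (a j) (simple_root e j)) = (\<Sum>j<e. scale (b j) (simple_root e j))"
    and "j < e"
  shows "a j = b j"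
proof -
  define c where "c = (\<lambda>j. a j - b j)"
  have row: "2 * c i = c ((i + 1) mod e) + c ((i + e - 1) mod e)" if "i < e" for i
    using root_combination_apply[OF e that, of a] root_combination_apply[OF e that, of b] eq
    by (simp add: c_def)
  have "snd (\<Sum>j<e. scale (a j) (simple_root e j)) = a 0" for a
  proof -
    have "snd (\<Sum>j<e. scale (a j) (simple_root e j)) = (\<Sum>j<e. if j = 0 then a j else 0)"
      by (simp add: snd_sum scale_def simple_root_def if_distrib cong: if_cong)
    then show ?thesis using e by simp
  qed
  then have c0: "c 0 = 0" using eq by (metis c_def diff_self)
  have lin: "c i = real i * c 1 \<and> c (i + 1) = real (i + 1) * c 1" if "i + 1 < e" for i
    using that
  proof (induction i)
    case (Suc i)
    have "2 * c (Suc i) = c (i + 2) + c i"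
      using row[of "Suc i"] Suc.prems by simp
    then show ?case using Suc by (auto simp: algebra_simps)
  qed (simp add: c0)
  have "2 * c (e - 1) = c (e - 2)"
    using row[of "e - 1"] e c0 by (auto simp: mod_if numeral_2_eq_2)
  then have "2 * (real (e - 1) * c 1) = real (e - 2) * c 1"
    using lin[of "e - 2"] e by (auto simp: numeral_2_eq_2 Suc_diff_Suc)
  then have "real e * c 1 = 0" using e by (simp add: of_nat_diff algebra_simps)
  then have "c 1 = 0" using e by simp
  then have "c j = 0" using lin[of "j - 1"] c0 \<open>j < e\<close> by (cases j) auto
  then show ?thesis by (simp add: c_def)
qed

definition root_sum :: "nat \<Rightarrow> profile \<Rightarrow> weight" where
  "root_sum e t = (\<Sum>j<e. scale (real_of_int (content_count e t (int j))) (simple_root e j))"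

text \<open>
  Reflecting a weight changes the coefficient of one simple root by the pairing with its coroot,
  which is the change of the number of boxes of that residue in \<open>content_count_reflect_same\<close>.
\<close>
lemma act_weight_word:
  assumes e: "e \<ge> 3" and "set w \<subseteq> {..<e}"
  shows "act_weight e w (fundamental_weight 0)
    = fundamental_weight 0 - root_sum e (foldr (reflect e) w ground)"
  using assms(2)
proof (induction w)
  case Nil
  then show ?case by (simp add: act_weight_def root_sum_def content_count_def scale_zero)
next
  case (Cons i w)
  define t where "t = foldr (reflect e) w ground"
  define a where "a = (\<lambda>j. real_of_int (content_count e t (int j)))"
  define v where "v = fundamental_weight 0 - root_sum e t"
  have i: "i < e" using Cons.prems by simp
  have t: "is_profile t"
    using core_profile_word[OF core_profile_ground, of e w] e unfolding t_def by (simp add: core_profile_imp_profile)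
  have "fst v i = (if i = 0 then 1 else 0) - (2 * a i - a ((i + 1) mod e) - a ((i + e - 1) mod e))"
    unfolding root_combination_apply[OF e i, symmetric]
    by (simp add: v_def root_sum_def a_def fundamental_weight_def)
  moreover have "content_count e t (int ((i + 1) mod e)) = content_count e t (int i + 1)"
    by (rule content_count_cong) (simp add: zmod_int mod_eq_dvd_iff[symmetric] ac_simps)
  moreover have "content_count e t (int ((i + e - 1) mod e)) = content_count e t (int i - 1)"
  proof (rule content_count_cong)
    have "int (i + e - 1) = (int i - 1) + int e" using e by simp
    then have "int ((i + e - 1) mod e) mod int e = (int i - 1) mod int e" by (simp add: zmod_int)
    then show "int e dvd int ((i + e - 1) mod e) - (int i - 1)" by (simp only: mod_eq_dvd_iff)
  qed
  ultimately have new: "real_of_int (content_count e (reflect e i t) (int i)) = a i + fst v i"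
    unfolding content_count_reflect_same[OF t i] by (simp add: a_def)
  have "root_sum e (reflect e i t) = (\<Sum>j<e. scale (a j) (simple_root e j)
      + (if j = i then scale (fst v i) (simple_root e i) else 0))"
    unfolding root_sum_def
  proof (intro sum.cong refl)
    fix j assume "j \<in> {..<e}"
    then show "scale (real_of_int (content_count e (reflect e i t) (int j))) (simple_root e j) =
      scale (a j) (simple_root e j) + (if j = i then scale (fst v i) (simple_root e i) else 0)"
      using new content_count_reflect_other[OF i, of j t]
      by (cases "j = i") (auto simp: scale_add_left a_def)
  qed
  also have "\<dots> = root_sum e t + scale (fst v i) (simple_root e i)"
    using i by (simp add: sum.distrib root_sum_def a_def)
  finally show ?case
    using Cons by (simp add: act_weight_def weight_reflection_def coroot_pairing_def t_def v_def)
qed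

section \<open>Roots of the types $D^{(2)}_{n+1}$ and $D^{(1)}_n$\<close>

lemma sum_ends: "n \<ge> 1 \<Longrightarrow> (\<Sum>i=0..n. f i) = f 0 + (\<Sum>i=1..<n. f i) + f n"
  for f :: "nat \<Rightarrow> 'a::comm_monoid_add"
proof -
  assume "n \<ge> 1"
  then have "{0..n} = insert 0 (insert n {1..<n})" by auto
  then show ?thesis using \<open>n \<ge> 1\<close> by (simp add: ac_simps)
qed

lemma sum_folded:
  fixes f :: "nat \<Rightarrow> 'a::comm_monoid_add"
  assumes "n \<ge> 1"
  shows "(\<Sum>j<2 * n. f j) = f 0 + (\<Sum>i=1..<n. f i + f (2 * n - i)) + f n"
proof -
  have "{..<2 * n} = insert 0 (insert n ({1..<n} \<union> {n + 1..<2 * n}))" using assms by auto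
  then have "(\<Sum>j<2 * n. f j) = f 0 + (f n + ((\<Sum>i=1..<n. f i) + (\<Sum>i=n + 1..<2 * n. f i)))"
    using assms by (simp add: sum.union_disjoint)
  moreover have "(\<Sum>i=n + 1..<2 * n. f i) = (\<Sum>i=1..<n. f (2 * n - i))"
    by (rule sum.reindex_bij_witness[of _ "\<lambda>i. 2 * n - i" "\<lambda>i. 2 * n - i"]) auto
  ultimately show ?thesis by (simp add: sum.distrib ac_simps)
qed

lemma D2_combination:
  assumes "n \<ge> 1"
  shows "(\<Sum>i=0..n. scale (a i) (root_D2 n i))
    = (\<Sum>j<2 * n. scale (a (min j (2 * n - j))) (simple_root (2 * n) j))"
  unfolding sum_ends[OF assms] sum_folded[OF assms]
  using assms by (auto simp: root_D2_def scale_add_right min_def intro!: sum.cong)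

text \<open>
  The coefficients, in the roots of type $D^{(2)}_{n+1}$, of the combination of roots of type
  $D^{(1)}_n$ with coefficients \<open>b\<close>.
\<close>
definition D1_to_D2 :: "nat \<Rightarrow> (nat \<Rightarrow> real) \<Rightarrow> nat \<Rightarrow> real" where
  "D1_to_D2 n b i = (if i = 0 \<or> i = n then 2 * b i else b i)
     + (if i = 1 then b 0 else 0) + (if i = n - 1 then b n else 0)"

lemma D1_combination:
  assumes "n \<ge> 2"
  shows "(\<Sum>i=0..n. scale (b i) (root_D1 n i)) = (\<Sum>i=0..n. scale (D1_to_D2 n b i) (root_D2 n i))"
proof -
  let ?f = "\<lambda>i. scale (if i = 0 \<or> i = n then 2 * b i else b i) (root_D2 n i)"
  have "(\<Sum>i=0..n. scale (b i) (root_D1 n i)) = (\<Sum>i=0..n. ?f i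
      + (if i = 0 then scale (b 0) (root_D2 n 1) else 0)
      + (if i = n then scale (b n) (root_D2 n (n - 1)) else 0))"
    using assms by (intro sum.cong) (auto simp: root_D1_def scale_add_right scale_scale mult.commute)
  also have "\<dots> = (\<Sum>i=0..n. ?f i) + scale (b 0) (root_D2 n 1) + scale (b n) (root_D2 n (n - 1))"
    by (simp add: sum.distrib)
  also have "\<dots> = (\<Sum>i=0..n. ?f i
      + (if i = 1 then scale (b 0) (root_D2 n i) else 0)
      + (if i = n - 1 then scale (b n) (root_D2 n i) else 0))"
    using assms by (simp add: sum.distrib)
  also have "\<dots> = (\<Sum>i=0..n. scale (D1_to_D2 n b i) (root_D2 n i))"
    by (intro sum.cong) (simp_all add: D1_to_D2_def scale_add_left scale_zero)
  finally show ?thesis .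
qed

lemma dtype_roots_independent:
  assumes n: "n \<ge> 2" and "i \<le> n"
    and eq: "(\<Sum>i=0..n. scale (a i) (dtype_root X n i)) = (\<Sum>i=0..n. scale (b i) (dtype_root X n i))"
  shows "a i = b i"
proof -
  have indep: "a i = b i" if "i \<le> n"
    and eq: "(\<Sum>i=0..n. scale (a i) (root_D2 n i)) = (\<Sum>i=0..n. scale (b i) (root_D2 n i))" for a b i
  proof -
    have "(\<Sum>j<2 * n. scale (a (min j (2 * n - j))) (simple_root (2 * n) j))
        = (\<Sum>j<2 * n. scale (b (min j (2 * n - j))) (simple_root (2 * n) j))"
      using eq D2_combination[of n] n by simp
    then have "a (min i (2 * n - i)) = b (min i (2 * n - i))"
      using n that(1) by (intro simple_roots_independent[of "2 * n" "\<lambda>j. a (min j (2 * n - j))"]) auto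
    moreover have "min i (2 * n - i) = i" using that(1) by (simp add: min_def)
    ultimately show ?thesis by simp
  qed
  show ?thesis
  proof (cases X)
    case D2
    then show ?thesis using indep[OF assms(2), of a b] eq by simp
  next
    case D1
    then have *: "D1_to_D2 n a i = D1_to_D2 n b i" if "i \<le> n" for i
      using indep[OF that, of "D1_to_D2 n a" "D1_to_D2 n b"] eq D1_combination[OF n] by simp
    have "a 0 = b 0" "a n = b n" using *[of 0] *[of n] n by (auto simp: D1_to_D2_def split: if_splits)
    then show ?thesis using *[OF assms(2)] by (auto simp: D1_to_D2_def split: if_splits)
  qed
qed

text \<open>
  Every word that produces the core also produces the weight given by its residue counts, so the
  description has only one solution; it has one at all because the core lies in the orbit.
\<close>
lemma root_coeff_eqI:
  assumes n: "n \<ge> 2" and t: "t \<in> orbit X n" and b: "\<And>i. i > n \<Longrightarrow> b i = 0"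
    and sum: "root_sum (2 * n) t = (\<Sum>i=0..n. scale (b i) (dtype_root X n i))"
  shows "root_coeff X n (diagram_of t) = b"
  unfolding root_coeff_def
proof (rule the_equality)
  have core: "core_profile (2 * n) (foldr (reflect (2 * n)) w ground)" for w
    using core_profile_word[OF core_profile_ground] n by simp
  have weight: "fundamental_weight 0 - act_weight (2 * n) w (fundamental_weight 0)
      = root_sum (2 * n) (foldr (reflect (2 * n)) w ground)" if "w \<in> weyl_words X n" for w
    using act_weight_word[of "2 * n" w] weyl_word_letters[OF n that] n by simp
  have act: "act_core (2 * n) w {} = diagram_of (foldr (reflect (2 * n)) w ground)"
    if "w \<in> weyl_words X n" for w
    using act_core_diagram_of[OF core_profile_ground, of "2 * n" w] weyl_word_letters[OF n that] n
    by (simp add: diagram_of_ground)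
  obtain w where w: "w \<in> weyl_words X n" "t = foldr (reflect (2 * n)) w ground"
    using orbit_word[OF t] by blast
  show "(\<forall>i>n. b i = 0) \<and> (\<exists>w\<in>weyl_words X n. act_core (2 * n) w {} = diagram_of t \<and>
      fundamental_weight 0 - act_weight (2 * n) w (fundamental_weight 0)
        = (\<Sum>i=0..n. scale (b i) (dtype_root X n i)))"
    using b w(1) act[OF w(1)] weight[OF w(1)] sum w(2) by auto
  fix a
  assume a: "(\<forall>i>n. a i = 0) \<and> (\<exists>w\<in>weyl_words X n. act_core (2 * n) w {} = diagram_of t \<and>
      fundamental_weight 0 - act_weight (2 * n) w (fundamental_weight 0)
        = (\<Sum>i=0..n. scale (a i) (dtype_root X n i)))"
  then obtain w' where w': "w' \<in> weyl_words X n" "act_core (2 * n) w' {} = diagram_of t"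
      "fundamental_weight 0 - act_weight (2 * n) w' (fundamental_weight 0)
        = (\<Sum>i=0..n. scale (a i) (dtype_root X n i))" by blast
  have "foldr (reflect (2 * n)) w' ground = t"
    using diagram_of_inject core_profile_imp_profile core act[OF w'(1)] w'(2) w(2) by metis
  then have "(\<Sum>i=0..n. scale (a i) (dtype_root X n i)) = (\<Sum>i=0..n. scale (b i) (dtype_root X n i))"
    using weight[OF w'(1)] w'(3) sum by simp
  then have "a i = b i" if "i \<le> n" for i using dtype_roots_independent[OF n that] by blast
  then show "a = b" using a b by (metis ext not_le)
qed

lemma sum_residue_count:
  assumes "finite c" "e > 0"
  shows "(\<Sum>j<e. residue_count e j c) = card c"
proof -
  have "residue e b < e" for b
    using assms(2) by (simp add: residue_def nat_less_iff)
  then have "(\<Sum>j<e. card {b \<in> c. residue e b = j}) = card c"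
    using assms sum.group[of c "{..<e}" "residue e" "\<lambda>_. 1 :: nat"]
    by (auto simp: image_subset_iff)
  then show ?thesis by (simp add: residue_count_def)
qed

theorem proposition5p12:
  fixes n :: nat and c :: diagram
  assumes "n \<ge> 4" and "c \<in> sc_even_cores (2 * n)"
  shows "atomic_length D1 n c
           = atomic_length D2 n c - root_coeff D2 n c 0 - root_coeff D2 n c n \<and>
         atomic_length D2 n c - root_coeff D2 n c 0 - root_coeff D2 n c n
           = 1 / 2 * (real (card c) - real (residue_count (2 * n) 0 c)
                        - real (residue_count (2 * n) n c))"
proof -
  have n: "n \<ge> 4" "n \<ge> 2" "n \<ge> 1" using assms(1) by auto
  have c: "c \<in> cores (2 * n)" "c\<inverse> = c" "even (card {i. (i, i) \<in> c})"
    using assms(2) by (auto simp: sc_even_cores_def sc_cores_def)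
  obtain t where t: "core_profile (2 * n) t" and c_t: "c = diagram_of t"
    using core_has_core_profile[OF c(1)] n by auto
  have prof: "is_profile t" using core_profile_imp_profile[OF t] .
  have sc: "self_conjugate t" using self_conjugate_diagram[OF prof] c(2) c_t by simp
  have "even (int (card {i. (i, i) \<in> diagram_of t}))" using c(3) c_t by simp
  then have even: "even (t 0)" unfolding diagonal_length[OF prof] .
  define r where "r = (\<lambda>j. real (residue_count (2 * n) j c))"
  have r: "r j = real_of_int (content_count (2 * n) t (int j))" if "j < 2 * n" for j
    using residue_count_diagram_of[OF prof that] unfolding r_def c_t by (metis of_int_of_nat_eq)
  have r_sym: "r (2 * n - j) = r j" if "0 < j" "j < 2 * n" for j
  proof -
    have "content_count (2 * n) t (int (2 * n - j)) = content_count (2 * n) t (- int j)"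
      using that by (intro content_count_cong) (simp add: of_nat_diff)
    then show ?thesis
      using that content_count_self_conjugate[OF sc, of "2 * n" "int j"] by (simp add: r)
  qed
  define a where "a = (\<lambda>i. if i \<le> n then r i else 0)"
  \<comment> \<open>obtained by solving \<open>D1_to_D2 n b i = a i\<close> for \<open>b\<close>\<close>
  define b where "b = (\<lambda>i. if n < i then 0 else if i = 0 \<or> i = n then r i / 2
    else r i - (if i = 1 then r 0 / 2 else 0) - (if i = n - 1 then r n / 2 else 0))"
  have D2_sum: "root_sum (2 * n) t = (\<Sum>i=0..n. scale (a i) (root_D2 n i))"
    unfolding D2_combination[OF n(3)] root_sum_def
  proof (intro sum.cong refl)
    fix j assume "j \<in> {..<2 * n}"
    then have "a (min j (2 * n - j)) = r j" using r_sym[of j] by (auto simp: a_def min_def)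
    then show "scale (real_of_int (content_count (2 * n) t (int j))) (simple_root (2 * n) j)
        = scale (a (min j (2 * n - j))) (simple_root (2 * n) j)"
      using r \<open>j \<in> _\<close> by simp
  qed
  have D2: "root_coeff D2 n c = a"
    unfolding c_t using D2_sum
    by (intro root_coeff_eqI[OF n(2) core_in_orbit_D2[OF n(2) t sc]]) (auto simp: a_def)
  have "D1_to_D2 n b i = a i" if "i \<le> n" for i
    using that n by (auto simp: D1_to_D2_def a_def b_def)
  then have "root_sum (2 * n) t = (\<Sum>i=0..n. scale (b i) (root_D1 n i))"
    unfolding D1_combination[OF n(2)] D2_sum by (intro sum.cong) auto
  then have D1: "root_coeff D1 n c = b"
    unfolding c_t
    by (intro root_coeff_eqI[OF n(2) even_core_in_orbit_D1[OF n(1) t sc even]]) (auto simp: b_def)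
  have inner: "(\<Sum>i=1..<n. b i) = (\<Sum>i=1..<n. r i) - r 0 / 2 - r n / 2"
  proof -
    have "(\<Sum>i=1..<n. b i) = (\<Sum>i=1..<n. r i - (if i = 1 then r 0 / 2 else 0)
        - (if i = n - 1 then r n / 2 else 0))"
      by (intro sum.cong) (auto simp: b_def)
    moreover have "n - 1 \<in> {1..<n}" "1 \<in> {1..<n}" using n by auto
    ultimately show ?thesis by (simp add: sum_subtractf)
  qed
  have "(\<Sum>j<2 * n. r j) = real (card c)"
    using sum_residue_count[of c "2 * n"] finite_diagram_of[OF prof] n
    by (simp add: r_def c_t flip: of_nat_sum)
  moreover have "(\<Sum>j<2 * n. r j) = r 0 + 2 * (\<Sum>i=1..<n. r i) + r n"
    unfolding sum_folded[OF n(3)] sum_distrib_left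
    using r_sym by (intro arg_cong2[where f = "(+)"] sum.cong) auto
  moreover have "atomic_length D2 n c = r 0 + (\<Sum>i=1..<n. r i) + r n"
    unfolding atomic_length_def D2 sum_ends[OF n(3)] by (simp add: a_def)
  moreover have "atomic_length D1 n c = (\<Sum>i=1..<n. r i)"
    unfolding atomic_length_def D1 sum_ends[OF n(3)] inner using n by (simp add: b_def)
  moreover have "root_coeff D2 n c 0 = r 0" "root_coeff D2 n c n = r n"
    unfolding D2 by (auto simp: a_def)
  ultimately show ?thesis by (simp add: r_def)
qed

end
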